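(* Let $\rho(\xi,\eta)=(\bar\eta,\bar\xi)$ and $\tau(\xi,\eta)=(\eta,\xi)$ on $\mathbb{C}^2$. Let $$\varphi:\ \xi'=\lambda\xi+p(\xi,\eta),\quad \eta'=\bar\lambda\eta+q(\xi,\eta),$$ where $p,q$ are convergent power series starting with terms of order two, $\operatorname{Im}\lambda>0$, and suppose $\varphi$ is reversible with respect to $\tau$ (i.e. $\varphi^{-1}=\tau\varphi\tau$) and satisfies $\rho\varphi=\varphi\rho$. If $\lambda$ is not a root of unity, then there exists a formal transformation $\Phi$ with $\rho\Phi=\Phi\rho$, $\tau\Phi=\Phi\tau$ and $$\Phi\varphi\Phi^{-1}:\ \xi'=\lambda\xi e^{i\epsilon(\xi\eta)^s},\quad \eta'=\bar\lambda\eta e^{-i\epsilon(\xi\eta)^s},$$ where either $\epsilon=\pm1$ and $s$ is a positive integer, or $\epsilon=0$ and $s=\infty$. Moreover $\{\lambda,\epsilon,s\}$ is a full set of invariants of $\varphi$ under real formal transformations: two such maps are conjugate by a formal transformation $\Psi$ with $\rho\Psi=\Psi\rho$ if and only if their triples $(\lambda,\epsilon,s)$ coincide.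
   Context: A formal transformation is a map $(\xi,\eta)\mapsto(f(\xi,\eta),g(\xi,\eta))$ given by formal power series without constant terms and with invertible linear part. A transformation $\Psi$ satisfying $\rho\Psi=\Psi\rho$ is called real (reality condition). The reversibility and reality conditions force $|\lambda|=1$. *)

theory Defs
  imports Complex_Main "HOL-Library.Extended_Nat"
begin

text \<open>A formal power series in two variables is represented by its coefficient
  function: F i j is the coefficient of xi^i eta^j.\<close>
type_synonym fps2 = "nat \<Rightarrow> nat \<Rightarrow> complex"

type_synonym fmap2 = "fps2 \<times> fps2"

definition fps2_one :: fps2 where
  "fps2_one i j = (if i = 0 \<and> j = 0 then 1 else 0)"

definition fps2_X :: fps2 where
  "fps2_X i j = (if i = 1 \<and> j = 0 then 1 else 0)"

definition fps2_Y :: fps2 where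
  "fps2_Y i j = (if i = 0 \<and> j = 1 then 1 else 0)"

definition fps2_mult :: "fps2 \<Rightarrow> fps2 \<Rightarrow> fps2" where
  "fps2_mult a b i j = (\<Sum>k\<le>i. \<Sum>l\<le>j. a k l * b (i - k) (j - l))"

definition fps2_pow :: "fps2 \<Rightarrow> nat \<Rightarrow> fps2" where
  "fps2_pow a n = (fps2_mult a ^^ n) fps2_one"

text \<open>Substitution F(f,g) for series f, g without constant term: the monomial
  xi^k eta^l contributes f^k g^l, which has order at least k+l, so only
  finitely many terms contribute to each coefficient.\<close>
definition fps2_comp :: "fps2 \<Rightarrow> fps2 \<Rightarrow> fps2 \<Rightarrow> fps2" where
  "fps2_comp F f g i j =
     (\<Sum>k\<le>i+j. \<Sum>l\<le>i+j-k. F k l * fps2_mult (fps2_pow f k) (fps2_pow g l) i j)"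

definition fmap_comp :: "fmap2 \<Rightarrow> fmap2 \<Rightarrow> fmap2" (infixl "\<circ>\<^sub>f" 55) where
  "fmap_comp \<Phi> \<Psi> = (fps2_comp (fst \<Phi>) (fst \<Psi>) (snd \<Psi>), fps2_comp (snd \<Phi>) (fst \<Psi>) (snd \<Psi>))"

definition fmap_id :: fmap2 where
  "fmap_id = (fps2_X, fps2_Y)"

definition tau_map :: fmap2 where
  "tau_map = (fps2_Y, fps2_X)"

text \<open>rho(xi,eta) = (conj eta, conj xi) is anti-holomorphic; rho o Phi o rho is
  again a formal (holomorphic) map, whose coefficients are computed as follows:
  (rho o Phi o rho)(xi,eta) = (conj (g(conj eta, conj xi)), conj (f(conj eta, conj xi))).\<close>
definition rho_conj :: "fmap2 \<Rightarrow> fmap2" where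
  "rho_conj \<Phi> = ((\<lambda>i j. cnj (snd \<Phi> j i)), (\<lambda>i j. cnj (fst \<Phi> j i)))"

text \<open>Reality condition rho Phi = Phi rho (equivalently, since rho is an involution,
  rho Phi rho = Phi).\<close>
definition real_fmap :: "fmap2 \<Rightarrow> bool" where
  "real_fmap \<Phi> \<longleftrightarrow> rho_conj \<Phi> = \<Phi>"

definition formal_transformation :: "fmap2 \<Rightarrow> bool" where
  "formal_transformation \<Phi> \<longleftrightarrow>
     fst \<Phi> 0 0 = 0 \<and> snd \<Phi> 0 0 = 0 \<and>
     fst \<Phi> 1 0 * snd \<Phi> 0 1 - fst \<Phi> 0 1 * snd \<Phi> 1 0 \<noteq> 0"

definition fps2_convergent :: "fps2 \<Rightarrow> bool" where
  "fps2_convergent F \<longleftrightarrow> (\<exists>C r. r > 0 \<and> (\<forall>i j. norm (F i j) * r ^ (i + j) \<le> C))"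

definition fps2_order_ge2 :: "fps2 \<Rightarrow> bool" where
  "fps2_order_ge2 F \<longleftrightarrow> F 0 0 = 0 \<and> F 1 0 = 0 \<and> F 0 1 = 0"

definition phi_map :: "complex \<Rightarrow> fps2 \<Rightarrow> fps2 \<Rightarrow> fmap2" where
  "phi_map lam p q =
     ((\<lambda>i j. lam * fps2_X i j + p i j), (\<lambda>i j. cnj lam * fps2_Y i j + q i j))"

definition admissible :: "complex \<Rightarrow> fps2 \<Rightarrow> fps2 \<Rightarrow> bool" where
  "admissible lam p q \<longleftrightarrow>
     fps2_convergent p \<and> fps2_convergent q \<and>
     fps2_order_ge2 p \<and> fps2_order_ge2 q \<and>
     Im lam > 0 \<and>
     phi_map lam p q \<circ>\<^sub>f (tau_map \<circ>\<^sub>f phi_map lam p q \<circ>\<^sub>f tau_map) = fmap_id \<and>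
     (tau_map \<circ>\<^sub>f phi_map lam p q \<circ>\<^sub>f tau_map) \<circ>\<^sub>f phi_map lam p q = fmap_id \<and>
     real_fmap (phi_map lam p q)"

text \<open>Normal form xi' = lambda xi exp(i eps (xi eta)^s),
  eta' = conj lambda eta exp(-i eps (xi eta)^s); for s = infinity it is linear.\<close>
definition normal_form :: "complex \<Rightarrow> int \<Rightarrow> enat \<Rightarrow> fmap2" where
  "normal_form lam eps s =
     (if s = \<infinity> then (\<lambda>i j. lam * fps2_X i j, \<lambda>i j. cnj lam * fps2_Y i j)
      else (let n = the_enat s; c = \<i> * of_int eps in
        ((\<lambda>i j. if i = Suc j \<and> n dvd j then lam * c ^ (j div n) / fact (j div n) else 0),
         (\<lambda>i j. if j = Suc i \<and> n dvd i then cnj lam * (- c) ^ (i div n) / fact (i div n) else 0))))"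

definition valid_invariants :: "int \<Rightarrow> enat \<Rightarrow> bool" where
  "valid_invariants eps s \<longleftrightarrow>
     ((eps = 1 \<or> eps = -1) \<and> s \<noteq> \<infinity> \<and> s > 0) \<or> (eps = 0 \<and> s = \<infinity>)"

definition has_normal_form :: "fmap2 \<Rightarrow> complex \<Rightarrow> int \<Rightarrow> enat \<Rightarrow> bool" where
  "has_normal_form \<phi> lam eps s \<longleftrightarrow>
     (\<exists>\<Phi>. formal_transformation \<Phi> \<and> real_fmap \<Phi> \<and>
          tau_map \<circ>\<^sub>f \<Phi> = \<Phi> \<circ>\<^sub>f tau_map \<and>
          \<Phi> \<circ>\<^sub>f \<phi> = normal_form lam eps s \<circ>\<^sub>f \<Phi>)"

definition real_formally_conjugate :: "fmap2 \<Rightarrow> fmap2 \<Rightarrow> bool" where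
  "real_formally_conjugate \<phi> \<phi>' \<longleftrightarrow>
     (\<exists>\<Psi>. formal_transformation \<Psi> \<and> real_fmap \<Psi> \<and> \<Psi> \<circ>\<^sub>f \<phi> = \<phi>' \<circ>\<^sub>f \<Psi>)"

end

theory Submission
  imports Defs "HOL-Computational_Algebra.Formal_Power_Series"
begin

text \<open>Since \<open>\<lambda>\<close> is not a root of unity, the equation \<open>\<Phi> \<circ> \<phi> = N \<circ> \<Phi>\<close> can be solved degree by degree
  with \<open>N = (\<lambda> \<xi> \<alpha>(\<xi>\<eta>), \<mu> \<eta> \<beta>(\<xi>\<eta>))\<close>, \<open>\<mu> = cnj \<lambda>\<close>, and the solution is unique once \<open>\<Phi>\<close> is tangent to
  the identity and has no resonant terms. Uniqueness makes \<open>\<Phi>\<close> commute with \<open>\<rho>\<close> and \<open>\<tau>\<close>, so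
  \<open>\<beta> = cnj \<alpha>\<close>, and \<open>N\<close> is again reversible. With \<open>\<kappa> = \<xi>\<eta>\<close> and \<open>m = \<alpha> \<beta>\<close> reversibility
  reads \<open>m(\<kappa>) m(\<kappa> m(\<kappa>)) = 1\<close>, which forces \<open>m = 1\<close>. Hence \<open>\<alpha> = exp (\<i> b)\<close> with \<open>b\<close> real; writing
  \<open>b = \<epsilon> \<kappa>\<^sup>s r\<^sup>2\<^sup>s\<close>, the map \<open>(\<xi> r(\<kappa>), \<eta> r(\<kappa>))\<close> removes \<open>r\<close>. A real conjugacy between two normal forms
  has linear part \<open>(a \<xi>, cnj a \<eta>)\<close> and multiplies the first resonant coefficient by a power of
  \<open>\<bar>a\<bar>\<^sup>2 > 0\<close>, so it preserves \<open>s\<close> and \<open>\<epsilon>\<close>.\<close>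

unbundle fps_syntax

section \<open>Power series in two variables and substitution\<close>

text \<open>Nesting the univariate type supplies the ring structure. The outer index is the exponent
  of \<open>serX\<close>, the inner one that of \<open>serY\<close>.\<close>

type_synonym ser = "complex fps fps"

definition Cst :: "complex \<Rightarrow> ser" where "Cst c = fps_const (fps_const c)"
definition serX :: ser where "serX = fps_X"
definition serY :: ser where "serY = fps_const fps_X"

definition ser :: "(nat \<Rightarrow> nat \<Rightarrow> complex) \<Rightarrow> ser" where
  "ser F = Abs_fps (\<lambda>i. Abs_fps (F i))"

lemma ser_nth [simp]: "ser F $ i $ j = F i j"
  by (simp add: ser_def)

lemma ser_eqI: "(\<And>i j. F $ i $ j = G $ i $ j) \<Longrightarrow> F = (G :: ser)"
  by (simp add: fps_eq_iff)

lemma ser_eq_iff: "F = (G :: ser) \<longleftrightarrow> (\<forall>i j. F $ i $ j = G $ i $ j)"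
  by (simp add: fps_eq_iff)

lemma Cst_nth: "Cst c $ i $ j = (if i = 0 \<and> j = 0 then c else 0)"
  by (simp add: Cst_def)

lemma serX_nth: "serX $ i $ j = (if i = 1 \<and> j = 0 then 1 else 0)"
  by (simp add: serX_def fps_X_def)

lemma serY_nth: "serY $ i $ j = (if i = 0 \<and> j = 1 then 1 else 0)"
  by (simp add: serY_def fps_X_def)

lemma ser_one_nth: "(1 :: ser) $ i $ j = (if i = 0 \<and> j = 0 then 1 else 0)"
  by simp

lemma ser_mult_nth:
  "((F :: ser) * G) $ i $ j = (\<Sum>k\<le>i. \<Sum>l\<le>j. F $ k $ l * G $ (i - k) $ (j - l))"
  by (simp add: fps_mult_nth fps_sum_nth atLeast0AtMost)

lemma Cst_mult_nth [simp]: "(Cst c * F) $ i $ j = c * F $ i $ j"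
  by (simp add: Cst_def)

lemma Cst_simps [simp]:
  "Cst 0 = 0" "Cst 1 = 1" "Cst (a + b) = Cst a + Cst b" "Cst (a * b) = Cst a * Cst b"
  by (simp_all add: Cst_def)

lemma serX_mult_nth: "(serX * F) $ i $ j = (if i = 0 then 0 else F $ (i - 1) $ j)"
  by (simp add: serX_def)

lemma serY_mult_nth: "(serY * F) $ i $ j = (if j = 0 then 0 else F $ i $ (j - 1))"
  by (simp add: serY_def)

section \<open>Filtration by total degree\<close>

definition ord_ge :: "nat \<Rightarrow> ser \<Rightarrow> bool" where
  "ord_ge n F \<longleftrightarrow> (\<forall>i j. i + j < n \<longrightarrow> F $ i $ j = 0)"

lemma ord_geD: "ord_ge n F \<Longrightarrow> i + j < n \<Longrightarrow> F $ i $ j = 0"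
  by (simp add: ord_ge_def)

lemma ord_ge_mono: "ord_ge n F \<Longrightarrow> m \<le> n \<Longrightarrow> ord_ge m F"
  by (simp add: ord_ge_def)

lemma ord_ge_add: "ord_ge n F \<Longrightarrow> ord_ge n G \<Longrightarrow> ord_ge n (F + G)"
  and ord_ge_0 [simp]: "ord_ge n 0" "ord_ge 0 F"
  and ord_ge_Cst_mult: "ord_ge n F \<Longrightarrow> ord_ge n (Cst c * F)"
  by (simp_all add: ord_ge_def)

lemma ord_ge_XY [simp]: "ord_ge (Suc 0) serX" "ord_ge (Suc 0) serY"
  by (simp_all add: ord_ge_def serX_nth serY_nth)

lemma ord_ge_mult:
  assumes "ord_ge m F" "ord_ge n G" shows "ord_ge (m + n) (F * G)"
  unfolding ord_ge_def
proof (intro allI impI)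
  fix i j :: nat assume ij: "i + j < m + n"
  have "F $ k $ l * G $ (i - k) $ (j - l) = 0" if "k \<le> i" "l \<le> j" for k l
  proof (cases "k + l < m")
    case True then show ?thesis using assms(1) by (simp add: ord_ge_def)
  next
    case False
    then have "(i - k) + (j - l) < n" using that ij by linarith
    then show ?thesis using assms(2) by (simp add: ord_ge_def)
  qed
  then show "(F * G) $ i $ j = 0" unfolding ser_mult_nth by (intro sum.neutral ballI) simp
qed

lemma ord_ge_power: "ord_ge (Suc 0) f \<Longrightarrow> ord_ge k (f ^ k)"
  by (induction k) (auto dest: ord_ge_mult)

lemma ord_ge_monom: "ord_ge (Suc 0) f \<Longrightarrow> ord_ge (Suc 0) g \<Longrightarrow> ord_ge (k + l) (f ^ k * g ^ l)"
  by (intro ord_ge_mult ord_ge_power)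

section \<open>Substitution as a ring homomorphism\<close>

definition subst :: "ser \<Rightarrow> ser \<Rightarrow> ser \<Rightarrow> ser" where
  "subst F f g = ser (\<lambda>i j. \<Sum>k\<le>i+j. \<Sum>l\<le>i+j-k. F $ k $ l * (f ^ k * g ^ l) $ i $ j)"

lemma subst_nth:
  "subst F f g $ i $ j = (\<Sum>k\<le>i+j. \<Sum>l\<le>i+j-k. F $ k $ l * (f ^ k * g ^ l) $ i $ j)"
  by (simp add: subst_def)

text \<open>Since \<open>f ^ k * g ^ l\<close> has order at least \<open>k + l\<close>, index pairs
  outside the triangle contribute zero. A square of fixed side, common to several coefficients,
  allows the later exchanges of sums.\<close>

lemma subst_nth_box:
  assumes "ord_ge (Suc 0) f" "ord_ge (Suc 0) g" "i + j \<le> N"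
  shows "subst F f g $ i $ j = (\<Sum>k\<le>N. \<Sum>l\<le>N. F $ k $ l * (f ^ k * g ^ l) $ i $ j)"
proof -
  have z: "(f ^ k * g ^ l) $ i $ j = 0" if "i + j < k + l" for k l
    using ord_ge_monom[OF assms(1,2), of k l] that by (rule ord_geD)
  have "(\<Sum>k\<le>N. \<Sum>l\<le>N. F $ k $ l * (f ^ k * g ^ l) $ i $ j)
      = (\<Sum>k\<le>i+j. \<Sum>l\<le>N. F $ k $ l * (f ^ k * g ^ l) $ i $ j)"
    using assms(3) by (intro sum.mono_neutral_right) (auto simp: z)
  also have "\<dots> = (\<Sum>k\<le>i+j. \<Sum>l\<le>i+j-k. F $ k $ l * (f ^ k * g ^ l) $ i $ j)"
    using assms(3) by (intro sum.cong refl sum.mono_neutral_right) (auto simp: z)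
  finally show ?thesis by (simp add: subst_nth)
qed

lemma subst_add: "subst (F + G) f g = subst F f g + subst G f g"
  by (rule ser_eqI) (simp add: subst_nth algebra_simps sum.distrib)

lemma subst_diff: "subst (F - G) f g = subst F f g - subst G f g"
  by (rule ser_eqI) (simp add: subst_nth algebra_simps sum_subtractf)

lemma subst_Cst_mult: "subst (Cst c * F) f g = Cst c * subst F f g"
  by (rule ser_eqI) (simp add: subst_nth sum_distrib_left mult.assoc)

lemma subst_0: "subst 0 f g = 0"
  by (rule ser_eqI) (simp add: subst_nth)

lemma subst_sum: "subst (sum F A) f g = (\<Sum>a\<in>A. subst (F a) f g)"
  by (induction A rule: infinite_finite_induct) (simp_all add: subst_0 subst_add)

lemma ord_ge_subst: assumes "ord_ge n F" shows "ord_ge n (subst F f g)"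
  unfolding ord_ge_def
proof (intro allI impI)
  fix i j :: nat assume "i + j < n"
  then have "F $ k $ l = 0" if "k \<le> i + j" "l \<le> i + j - k" for k l
    using that by (intro ord_geD[OF assms]) auto
  then show "subst F f g $ i $ j = 0" by (simp add: subst_nth)
qed

lemma subst_X [simp]: assumes "ord_ge (Suc 0) f" "ord_ge (Suc 0) g" shows "subst serX f g = f"
proof (rule ser_eqI)
  fix i j
  \<comment> \<open>The side \<open>Suc (i+j)\<close> keeps the index 1 inside the box even for
    \<open>i = j = 0\<close>.\<close>
  have "subst serX f g $ i $ j = (\<Sum>k\<le>Suc (i+j). \<Sum>l\<le>Suc (i+j). serX $ k $ l * (f ^ k * g ^ l) $ i $ j)"
    by (rule subst_nth_box[OF assms]) simp
  also have "\<dots> = (\<Sum>k\<le>Suc (i+j). if k = 1 then f $ i $ j else 0)"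
  proof (rule sum.cong[OF refl])
    fix k assume "k \<in> {..Suc (i+j)}"
    have "(\<Sum>l\<le>Suc (i+j). serX $ k $ l * (f ^ k * g ^ l) $ i $ j)
       = (\<Sum>l\<le>Suc (i+j). if l = 0 then (if k = 1 then f $ i $ j else 0) else 0)"
      by (rule sum.cong) (auto simp: serX_nth)
    then show "(\<Sum>l\<le>Suc (i+j). serX $ k $ l * (f ^ k * g ^ l) $ i $ j) = (if k = 1 then f $ i $ j else 0)"
      by simp
  qed
  also have "\<dots> = f $ i $ j" by simp
  finally show "subst serX f g $ i $ j = f $ i $ j" .
qed

lemma subst_Y [simp]: assumes "ord_ge (Suc 0) f" "ord_ge (Suc 0) g" shows "subst serY f g = g"
proof (rule ser_eqI)
  fix i j
  have "subst serY f g $ i $ j = (\<Sum>k\<le>Suc (i+j). \<Sum>l\<le>Suc (i+j). serY $ k $ l * (f ^ k * g ^ l) $ i $ j)"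
    by (rule subst_nth_box[OF assms]) simp
  also have "\<dots> = (\<Sum>k\<le>Suc (i+j). if k = 0 then g $ i $ j else 0)"
  proof (rule sum.cong[OF refl])
    fix k assume "k \<in> {..Suc (i+j)}"
    have "(\<Sum>l\<le>Suc (i+j). serY $ k $ l * (f ^ k * g ^ l) $ i $ j)
       = (\<Sum>l\<le>Suc (i+j). if l = 1 then (if k = 0 then g $ i $ j else 0) else 0)"
      by (rule sum.cong) (auto simp: serY_nth)
    then show "(\<Sum>l\<le>Suc (i+j). serY $ k $ l * (f ^ k * g ^ l) $ i $ j) = (if k = 0 then g $ i $ j else 0)"
      by simp
  qed
  also have "\<dots> = g $ i $ j" by simp
  finally show "subst serY f g $ i $ j = g $ i $ j" .
qed

lemma subst_1 [simp]: "subst 1 f g = 1"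
proof (rule ser_eqI)
  fix i j
  have "subst 1 f g $ i $ j = (\<Sum>k\<le>i+j. if k = 0 then 1 $ i $ j else 0)"
    unfolding subst_nth
  proof (rule sum.cong[OF refl])
    fix k
    have "(\<Sum>l\<le>i+j-k. 1 $ k $ l * (f ^ k * g ^ l) $ i $ j)
       = (\<Sum>l\<le>i+j-k. if l = 0 then (if k = 0 then 1 $ i $ j else 0) else 0)"
      by (rule sum.cong) (auto simp: ser_one_nth simp del: fps_one_nth)
    then show "(\<Sum>l\<le>i+j-k. 1 $ k $ l * (f ^ k * g ^ l) $ i $ j) = (if k = 0 then 1 $ i $ j else 0)"
      by simp
  qed
  then show "subst 1 f g $ i $ j = 1 $ i $ j" by simp
qed

lemma sum_triangle:
  fixes a :: "nat \<Rightarrow> nat \<Rightarrow> complex"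
  assumes "\<And>k k'. k + k' > N \<Longrightarrow> a k k' = 0"
  shows "(\<Sum>k\<le>N. \<Sum>k'\<le>N. a k k') = (\<Sum>m\<le>N. \<Sum>k\<le>m. a k (m - k))"
proof -
  have "(\<Sum>k\<le>N. \<Sum>k'\<le>N. a k k') = (\<Sum>(k,k')\<in>{..N} \<times> {..N}. a k k')"
    by (simp add: sum.cartesian_product)
  also have "\<dots> = (\<Sum>(k,k')\<in>{(k,k'). k + k' \<le> N}. a k k')"
    by (intro sum.mono_neutral_right) (auto intro: assms leI)
  also have "\<dots> = (\<Sum>m\<le>N. \<Sum>k\<le>m. a k (m - k))"
    by (rule sum.triangle_reindex_eq)
  finally show ?thesis .
qed

text \<open>Only finitely many coefficients of \<open>F\<close> and \<open>G\<close> influence a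
  given coefficient, so both substitutions may be replaced by the finite sums \<open>S F\<close> and
  \<open>S G\<close>. Regrouping their product along \<open>m = k + k'\<close> and
  \<open>n = l + l'\<close> produces the coefficients of \<open>F * G\<close>.\<close>

lemma subst_mult:
  assumes "ord_ge (Suc 0) f" "ord_ge (Suc 0) g"
  shows "subst (F * G) f g = subst F f g * subst G f g"
proof (rule ser_eqI)
  fix i j :: nat
  define N where "N = i + j"
  define S where "S H = (\<Sum>k\<le>N. \<Sum>l\<le>N. Cst (H $ k $ l) * (f ^ k * g ^ l))" for H :: ser
  define c where "c k l = (f ^ k * g ^ l) $ i $ j" for k l
  have cz: "c k l = 0" if "k + l > N" for k l
    unfolding c_def using ord_ge_monom[OF assms, of k l] that N_def by (intro ord_geD) auto
  have S: "subst H f g $ i' $ j' = S H $ i' $ j'" if "i' + j' \<le> N" for H i' j'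
    unfolding S_def by (simp add: subst_nth_box[OF assms that] fps_sum_nth)
  have "(subst F f g * subst G f g) $ i $ j = (S F * S G) $ i $ j"
    unfolding ser_mult_nth by (intro sum.cong refl arg_cong2[where f = "(*)"] S) (auto simp: N_def)
  also have "S F * S G = (\<Sum>k\<le>N. \<Sum>l\<le>N. \<Sum>k'\<le>N. \<Sum>l'\<le>N.
      Cst (F $ k $ l * G $ k' $ l') * (f ^ (k + k') * g ^ (l + l')))"
    unfolding S_def sum_distrib_right unfolding sum_distrib_left
    by (intro sum.cong refl) (simp add: power_add ac_simps)
  also have "\<dots> $ i $ j = (\<Sum>k\<le>N. \<Sum>l\<le>N. \<Sum>k'\<le>N. \<Sum>l'\<le>N.
      F $ k $ l * G $ k' $ l' * c (k + k') (l + l'))"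
    by (simp add: fps_sum_nth c_def del: Cst_simps)
  also have "\<dots> = (\<Sum>k\<le>N. \<Sum>k'\<le>N. \<Sum>l\<le>N. \<Sum>l'\<le>N.
      F $ k $ l * G $ k' $ l' * c (k + k') (l + l'))"
    by (rule sum.cong[OF refl], rule sum.swap)
  \<comment> \<open>Pairs with \<open>k + k' > N\<close> drop out because \<open>c\<close> vanishes
    there, so the square can be summed along antidiagonals.\<close>
  also have "\<dots> = (\<Sum>m\<le>N. \<Sum>k\<le>m. \<Sum>l\<le>N. \<Sum>l'\<le>N.
      F $ k $ l * G $ (m - k) $ l' * c (k + (m - k)) (l + l'))"
    by (rule sum_triangle) (auto intro!: sum.neutral simp: cz)
  also have "\<dots> = (\<Sum>m\<le>N. \<Sum>k\<le>m. \<Sum>n\<le>N. \<Sum>l\<le>n.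
      F $ k $ l * G $ (m - k) $ (n - l) * c (k + (m - k)) (l + (n - l)))"
    by (intro sum.cong refl sum_triangle) (auto simp: cz)
  also have "\<dots> = (\<Sum>m\<le>N. \<Sum>k\<le>m. \<Sum>n\<le>N. \<Sum>l\<le>n. F $ k $ l * G $ (m - k) $ (n - l) * c m n)"
    by (intro sum.cong refl) auto
  also have "\<dots> = (\<Sum>m\<le>N. \<Sum>n\<le>N. \<Sum>k\<le>m. \<Sum>l\<le>n. F $ k $ l * G $ (m - k) $ (n - l) * c m n)"
    by (rule sum.cong[OF refl], rule sum.swap)
  also have "\<dots> = subst (F * G) f g $ i $ j"
    by (simp add: subst_nth_box[OF assms order.refl] ser_mult_nth[of F G] sum_distrib_right c_def flip: N_def)
  finally show "subst (F * G) f g $ i $ j = (subst F f g * subst G f g) $ i $ j" ..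
qed

lemma subst_power:
  assumes "ord_ge (Suc 0) f" "ord_ge (Suc 0) g"
  shows "subst (F ^ n) f g = subst F f g ^ n"
  by (induction n) (simp_all add: subst_mult[OF assms])

text \<open>Up to degree \<open>N\<close> the series \<open>subst F f g\<close> agrees with the
  polynomial \<open>P\<close> in \<open>f\<close> and \<open>g\<close>. Substituting
  \<open>h\<close> and \<open>k\<close> does not lower the order of the error, and on polynomials it
  is a ring homomorphism.\<close>

lemma subst_assoc:
  assumes "ord_ge (Suc 0) f" "ord_ge (Suc 0) g" "ord_ge (Suc 0) h" "ord_ge (Suc 0) k"
  shows "subst (subst F f g) h k = subst F (subst f h k) (subst g h k)"
proof (rule ser_eqI)
  fix i j :: nat
  define N where "N = i + j"
  define P where "P = (\<Sum>m\<le>N. \<Sum>n\<le>N. Cst (F $ m $ n) * (f ^ m * g ^ n))"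
  have "ord_ge (Suc N) (subst F f g - P)"
    unfolding ord_ge_def P_def
    by (auto simp: fps_sum_nth subst_nth_box[OF assms(1,2)])
  then have "subst (subst F f g - P) h k $ i $ j = 0"
    using ord_ge_subst ord_geD N_def by blast
  then have "subst (subst F f g) h k $ i $ j = subst P h k $ i $ j"
    by (simp add: subst_diff)
  also have "\<dots> = subst F (subst f h k) (subst g h k) $ i $ j"
    unfolding P_def using assms
    by (simp add: subst_sum subst_Cst_mult subst_mult subst_power fps_sum_nth
        subst_nth_box[where N = N] ord_ge_subst N_def)
  finally show "subst (subst F f g) h k $ i $ j = subst F (subst f h k) (subst g h k) $ i $ j" .
qed

section \<open>Leading terms of substitutions\<close>

text \<open>Telescoping replaces one factor of order 1 by \<open>f' - f\<close>, of order
  \<open>e + 1\<close>, so the generic order \<open>k\<close> of a \<open>k\<close>-th power rises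
  by \<open>e\<close>.\<close>

lemma ord_ge_power_diff:
  assumes "ord_ge (Suc 0) f" "ord_ge (Suc 0) f'" "ord_ge (Suc e) (f' - f)"
  shows "ord_ge (k + e) (f' ^ k - f ^ k)"
proof (induction k)
  case 0 then show ?case by simp
next
  case (Suc k)
  have "f' ^ Suc k - f ^ Suc k = f' * (f' ^ k - f ^ k) + (f' - f) * f ^ k"
    by (simp add: algebra_simps)
  moreover have "ord_ge (Suc k + e) (f' * (f' ^ k - f ^ k))"
    using ord_ge_mult[OF assms(2) Suc] by simp
  moreover have "ord_ge (Suc k + e) ((f' - f) * f ^ k)"
    using ord_ge_mult[OF assms(3) ord_ge_power[OF assms(1), of k]] by (simp add: add.commute)
  ultimately show ?case by (metis ord_ge_add)
qed

text \<open>Each monomial of \<open>F\<close> has degree \<open>k + l \<ge> d\<close>, and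
  exchanging the arguments in it changes it only in degrees from \<open>k + l + e\<close> on. For
  \<open>d = 2\<close> this says that nonlinear terms react to a perturbation one degree later than
  linear ones.\<close>

lemma ord_ge_subst_diff:
  assumes "ord_ge d F"
    and "ord_ge (Suc 0) f" "ord_ge (Suc 0) f'" "ord_ge (Suc e) (f' - f)"
    and "ord_ge (Suc 0) g" "ord_ge (Suc 0) g'" "ord_ge (Suc e) (g' - g)"
  shows "ord_ge (d + e) (subst F f' g' - subst F f g)"
  unfolding ord_ge_def
proof (intro allI impI)
  fix i j :: nat assume ij: "i + j < d + e"
  have "F $ k $ l * (f' ^ k * g' ^ l) $ i $ j - F $ k $ l * (f ^ k * g ^ l) $ i $ j = 0" for k l
  proof (cases "k + l < d")
    case True then show ?thesis using assms(1) by (simp add: ord_ge_def)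
  next
    case False
    have eq: "f' ^ k * g' ^ l - f ^ k * g ^ l = f' ^ k * (g' ^ l - g ^ l) + (f' ^ k - f ^ k) * g ^ l"
      by (simp add: algebra_simps)
    have "ord_ge (k + l + e) (f' ^ k * (g' ^ l - g ^ l))"
      using ord_ge_mult[OF ord_ge_power[OF assms(3), of k] ord_ge_power_diff[OF assms(5-7), of l]]
      by (simp add: ac_simps)
    moreover have "ord_ge (k + l + e) ((f' ^ k - f ^ k) * g ^ l)"
      using ord_ge_mult[OF ord_ge_power_diff[OF assms(2-4), of k] ord_ge_power[OF assms(5), of l]]
      by (simp add: ac_simps)
    ultimately have "ord_ge (k + l + e) (f' ^ k * g' ^ l - f ^ k * g ^ l)"
      unfolding eq by (rule ord_ge_add)
    from ord_geD[OF this, of i j] have "(f' ^ k * g' ^ l - f ^ k * g ^ l) $ i $ j = 0"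
      using False ij by simp
    then show ?thesis by (simp add: algebra_simps)
  qed
  then show "(subst F f' g' - subst F f g) $ i $ j = 0"
    by (simp only: fps_sub_nth subst_nth sum.neutral_const flip: sum_subtractf)
qed

lemma ord_ge_linear: "ord_ge (Suc 0) (Cst a * serX)" "ord_ge (Suc 0) (Cst b * serY)"
  by (simp_all add: ord_ge_Cst_mult)

lemma monom_nth: "(serX ^ k * serY ^ l) $ i $ j = (if i = k \<and> j = l then 1 else 0)"
proof -
  have "serX ^ k * serY ^ l = fps_const (fps_X ^ l) * fps_X ^ k"
    by (simp add: serX_def serY_def fps_const_power)
  then show ?thesis by (simp add: fps_X_power_nth)
qed

text \<open>Monomials are eigenvectors of a diagonal linear substitution; for \<open>a = lam\<close>
  and \<open>b = mu\<close> the eigenvalues are the quantities compared in the resonance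
  condition.\<close>

lemma subst_linear_nth:
  "subst F (Cst a * serX) (Cst b * serY) $ i $ j = a ^ i * b ^ j * F $ i $ j"
proof -
  have m: "((Cst a * serX) ^ k * (Cst b * serY) ^ l) $ i $ j
      = a ^ k * b ^ l * (if i = k \<and> j = l then 1 else 0)" for k l
  proof -
    have "Cst a ^ k = Cst (a ^ k)" "Cst b ^ l = Cst (b ^ l)" by (simp_all add: Cst_def)
    then have "(Cst a * serX) ^ k * (Cst b * serY) ^ l = Cst (a ^ k) * (Cst (b ^ l) * (serX ^ k * serY ^ l))"
      by (simp add: power_mult_distrib)
    then show ?thesis by (simp only: Cst_mult_nth monom_nth mult.assoc)
  qed
  have "(\<Sum>k\<le>i+j. \<Sum>l\<le>i+j. F $ k $ l * ((Cst a * serX) ^ k * (Cst b * serY) ^ l) $ i $ j)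
      = (\<Sum>k\<le>i+j. \<Sum>l\<le>i+j. if l = j then (if k = i then a ^ i * b ^ j * F $ i $ j else 0) else 0)"
    by (intro sum.cong refl) (auto simp: m)
  also have "\<dots> = a ^ i * b ^ j * F $ i $ j" by simp
  finally show ?thesis by (simp add: subst_nth_box[OF ord_ge_linear order.refl])
qed

lemma subst_id [simp]: "subst F serX serY = F"
  using subst_linear_nth[of F 1 1] by (intro ser_eqI) simp

lemma ord_ge_1_from_linear:
  "ord_ge 2 (f - Cst a * serX) \<Longrightarrow> ord_ge (Suc 0) f" "ord_ge 2 (g - Cst b * serY) \<Longrightarrow> ord_ge (Suc 0) g"
proof -
  show "ord_ge 2 (f - Cst a * serX) \<Longrightarrow> ord_ge (Suc 0) f"
    using ord_ge_add[OF ord_ge_mono[of 2 "f - Cst a * serX" "Suc 0"] ord_ge_linear(1)[of a]] by simp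
  show "ord_ge 2 (g - Cst b * serY) \<Longrightarrow> ord_ge (Suc 0) g"
    using ord_ge_add[OF ord_ge_mono[of 2 "g - Cst b * serY" "Suc 0"] ord_ge_linear(2)[of b]] by simp
qed

text \<open>Replacing \<open>f\<close> and \<open>g\<close> by their linear parts changes the result
  only from degree \<open>n + 1\<close> on, and the linear substitution acts diagonally.\<close>

lemma subst_leading:
  assumes "ord_ge n F" "ord_ge 2 (f - Cst a * serX)" "ord_ge 2 (g - Cst b * serY)" "i + j \<le> n"
  shows "subst F f g $ i $ j = a ^ i * b ^ j * F $ i $ j"
proof -
  have "ord_ge (n + 1) (subst F f g - subst F (Cst a * serX) (Cst b * serY))"
    using assms ord_ge_linear ord_ge_1_from_linear by (intro ord_ge_subst_diff) (auto simp: numeral_2_eq_2)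
  from ord_geD[OF this, of i j] assms(4) show ?thesis by (simp add: subst_linear_nth)
qed

lemma subst_perturb:
  assumes M: "ord_ge 2 (M - (Cst a * serX + Cst b * serY))"
    and "ord_ge (Suc 0) f" "ord_ge (Suc 0) f'" "ord_ge n (f' - f)"
    and "ord_ge (Suc 0) g" "ord_ge (Suc 0) g'" "ord_ge n (g' - g)" and n: "n > 0" and ij: "i + j \<le> n"
  shows "subst M f' g' $ i $ j - subst M f g $ i $ j = a * (f' - f) $ i $ j + b * (g' - g) $ i $ j"
proof -
  define M2 where "M2 = M - (Cst a * serX + Cst b * serY)"
  have "M = Cst a * serX + Cst b * serY + M2" by (simp add: M2_def)
  then have s: "subst M u v = Cst a * u + Cst b * v + subst M2 u v"
    if "ord_ge (Suc 0) u" "ord_ge (Suc 0) v" for u v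
    using that by (simp add: subst_add subst_Cst_mult)
  \<comment> \<open>With \<open>d = 2\<close> and \<open>e = n - 1\<close> the nonlinear part
    \<open>M2\<close> changes only from degree \<open>n + 1\<close> on, so up to degree
    \<open>n\<close> the linear part of \<open>M\<close> accounts for the whole difference.\<close>
  have "ord_ge (2 + (n - 1)) (subst M2 f' g' - subst M2 f g)"
    using assms by (intro ord_ge_subst_diff) (auto simp: M2_def)
  from ord_geD[OF this, of i j] ij n have "subst M2 f' g' $ i $ j = subst M2 f g $ i $ j" by simp
  then show ?thesis using assms by (simp add: s right_diff_distrib)
qed

section \<open>Formal maps and conjugation to resonant form\<close>

type_synonym ser_pair = "ser \<times> ser"

definition mcomp :: "ser_pair \<Rightarrow> ser_pair \<Rightarrow> ser_pair" (infixl "\<odot>" 55) where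
  "\<Phi> \<odot> \<Psi> = (subst (fst \<Phi>) (fst \<Psi>) (snd \<Psi>), subst (snd \<Phi>) (fst \<Psi>) (snd \<Psi>))"

definition id_map :: ser_pair where "id_map = (serX, serY)"

definition no_const :: "ser_pair \<Rightarrow> bool" where
  "no_const \<Phi> \<longleftrightarrow> ord_ge (Suc 0) (fst \<Phi>) \<and> ord_ge (Suc 0) (snd \<Phi>)"

text \<open>The order conditions also exclude constant and off-diagonal linear terms, so
  \<open>a\<close> and \<open>b\<close> describe the full linear part.\<close>

definition diag_linear :: "complex \<Rightarrow> complex \<Rightarrow> ser_pair \<Rightarrow> bool" where
  "diag_linear a b \<Phi> \<longleftrightarrow> ord_ge 2 (fst \<Phi> - Cst a * serX) \<and> ord_ge 2 (snd \<Phi> - Cst b * serY)"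

lemma diag_linear_no_const: "diag_linear a b \<Phi> \<Longrightarrow> no_const \<Phi>"
  unfolding diag_linear_def no_const_def using ord_ge_1_from_linear by blast

lemma no_const_mcomp: "no_const \<Phi> \<Longrightarrow> no_const (\<Phi> \<odot> \<Psi>)"
  by (simp add: no_const_def mcomp_def ord_ge_subst)

lemma mcomp_assoc: "no_const \<Psi> \<Longrightarrow> no_const \<Omega> \<Longrightarrow> (\<Phi> \<odot> \<Psi>) \<odot> \<Omega> = \<Phi> \<odot> (\<Psi> \<odot> \<Omega>)"
  by (simp add: no_const_def mcomp_def subst_assoc)

lemma mcomp_id_map: "\<Phi> \<odot> id_map = \<Phi>" and id_map_mcomp: "no_const \<Phi> \<Longrightarrow> id_map \<odot> \<Phi> = \<Phi>"
  by (simp_all add: no_const_def mcomp_def id_map_def)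

lemma subst_linear_part:
  assumes M: "ord_ge 2 (M - (Cst a * serX + Cst b * serY))" and "ord_ge (Suc 0) u" "ord_ge (Suc 0) v"
  shows "ord_ge 2 (subst M u v - (Cst a * u + Cst b * v))"
proof -
  have "subst (M - (Cst a * serX + Cst b * serY)) u v = subst M u v - (Cst a * u + Cst b * v)"
    using assms by (simp add: subst_diff subst_add subst_Cst_mult)
  then show ?thesis using ord_ge_subst[OF M, of u v] by simp
qed

lemma diag_linear_mcomp: assumes "diag_linear a b \<Phi>" "diag_linear c d \<Psi>" shows "diag_linear (a * c) (b * d) (\<Phi> \<odot> \<Psi>)"
proof -
  have z: "ord_ge (Suc 0) (fst \<Psi>)" "ord_ge (Suc 0) (snd \<Psi>)" using diag_linear_no_const[OF assms(2)] by (auto simp: no_const_def)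
  have "ord_ge 2 (subst (fst \<Phi>) (fst \<Psi>) (snd \<Psi>) - (Cst a * fst \<Psi> + Cst 0 * snd \<Psi>))"
    using assms(1) by (intro subst_linear_part z) (simp add: diag_linear_def)
  from ord_ge_add[OF this ord_ge_Cst_mult[of 2 "fst \<Psi> - Cst c * serX" a]]
  have 1: "ord_ge 2 (fst (\<Phi> \<odot> \<Psi>) - Cst (a * c) * serX)"
    using assms(2) by (simp add: diag_linear_def mcomp_def algebra_simps)
  have "ord_ge 2 (subst (snd \<Phi>) (fst \<Psi>) (snd \<Psi>) - (Cst 0 * fst \<Psi> + Cst b * snd \<Psi>))"
    using assms(1) by (intro subst_linear_part z) (simp add: diag_linear_def)
  from ord_ge_add[OF this ord_ge_Cst_mult[of 2 "snd \<Psi> - Cst d * serY" b]]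
  have 2: "ord_ge 2 (snd (\<Phi> \<odot> \<Psi>) - Cst (b * d) * serY)"
    using assms(2) by (simp add: diag_linear_def mcomp_def algebra_simps)
  show ?thesis using 1 2 by (simp add: diag_linear_def)
qed

lemma diag_linear_eqI:
  assumes "diag_linear a b \<Phi>" "diag_linear a b \<Psi>"
    and "\<And>i j. 2 \<le> i + j \<Longrightarrow> fst \<Phi> $ i $ j = fst \<Psi> $ i $ j"
    and "\<And>i j. 2 \<le> i + j \<Longrightarrow> snd \<Phi> $ i $ j = snd \<Psi> $ i $ j"
  shows "\<Phi> = \<Psi>"
proof (rule prod_eqI; rule ser_eqI)
  fix i j
  show "fst \<Phi> $ i $ j = fst \<Psi> $ i $ j"
    using assms(1,2) assms(3)[of i j] by (cases "i + j < 2") (simp_all add: diag_linear_def ord_ge_def)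
  show "snd \<Phi> $ i $ j = snd \<Psi> $ i $ j"
    using assms(1,2) assms(4)[of i j] by (cases "i + j < 2") (simp_all add: diag_linear_def ord_ge_def)
qed

section \<open>Solving degree by degree, and inverse maps\<close>

text \<open>Equation \<open>a\<close> involves unknowns of lower degree and, with the nonzero factor
  \<open>d a\<close>, the unknown \<open>a\<close> itself. Well-founded recursion on
  \<open>deg\<close> therefore determines all unknowns.\<close>

lemma triangular_solution:
  fixes D :: "('a \<Rightarrow> 'b::field) \<Rightarrow> 'a \<Rightarrow> 'b" and deg :: "'a \<Rightarrow> nat"
  assumes D: "\<And>x y a. (\<And>b. deg b < deg a \<Longrightarrow> x b = y b) \<Longrightarrow> D y a - D x a = d a * (y a - x a)"
    and d: "\<And>a. d a \<noteq> 0"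
  shows "\<exists>x. \<forall>a. D x a = 0"
proof -
  \<comment> \<open>\<open>x a = T x a\<close> is equivalent to \<open>D x a = 0\<close>.
    Subtracting the quotient removes the dependence on \<open>x a\<close>, so \<open>T x a\<close>
    reads only values of lower degree.\<close>
  define T where "T x a = x a - D x a / d a" for x a
  have "adm_wf (measure deg) T"
    unfolding adm_wf_def
  proof (intro allI impI)
    fix x y :: "'a \<Rightarrow> 'b" and a assume "\<forall>b. (b, a) \<in> measure deg \<longrightarrow> x b = y b"
    then have "D y a - D x a = d a * (y a - x a)" by (intro D) auto
    then show "T x a = T y a" using d[of a] by (simp add: T_def field_simps)
  qed
  from wfrec_fixpoint[OF wf_measure this] have "wfrec (measure deg) T a = T (wfrec (measure deg) T) a" for a
    by (rule fun_cong)
  then show ?thesis using d by (intro exI[of _ "wfrec (measure deg) T"]) (simp add: T_def)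
qed

text \<open>The unknowns are the coefficients of the inverse, indexed by component
  (\<open>True\<close> for the first) and exponents. In each degree the new unknowns enter only
  through the linear part of \<open>\<Phi>\<close>, with the factors \<open>a\<close> and
  \<open>b\<close>.\<close>

lemma right_inverse_exists:
  assumes "diag_linear a b \<Phi>" "a \<noteq> 0" "b \<noteq> 0"
  shows "\<exists>\<Psi>. diag_linear (1 / a) (1 / b) \<Psi> \<and> \<Phi> \<odot> \<Psi> = id_map"
proof -
  define S where "S U c = ser (\<lambda>i j. if i + j = 0 then 0 else U (c, i, j))" for U :: "bool \<times> nat \<times> nat \<Rightarrow> complex" and c
  define f g where "f = fst \<Phi>" and "g = snd \<Phi>"
  \<comment> \<open>In degree 0 the equation is \<open>U (c, i, j) = 0\<close>: these unknowns are
    placeholders, because \<open>S\<close> already sets the constant term to zero.\<close>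
  define D where "D U = (\<lambda>(c, i, j). if i + j = 0 then U (c, i, j) else
      if c then (subst f (S U True) (S U False) - serX) $ i $ j
      else (subst g (S U True) (S U False) - serY) $ i $ j)" for U
  define d where "d = (\<lambda>(c, i :: nat, j :: nat). if i + j = 0 then 1 else if c then a else b)"
  define deg where "deg = (\<lambda>(c :: bool, i :: nat, j). i + j)"
  have fg: "ord_ge 2 (f - (Cst a * serX + Cst 0 * serY))" "ord_ge 2 (g - (Cst 0 * serX + Cst b * serY))"
    using assms(1) by (simp_all add: diag_linear_def f_def g_def)
  have S1: "ord_ge (Suc 0) (S U c)" for U c by (simp add: S_def ord_ge_def)
  have "\<exists>U. \<forall>x. D U x = 0"
  proof (rule triangular_solution)
    fix U V :: "bool \<times> nat \<times> nat \<Rightarrow> complex" and x assume UV: "\<And>y. deg y < deg x \<Longrightarrow> U y = V y"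
    obtain c i j where x: "x = (c, i, j)" by (cases x)
    have "ord_ge (i + j) (S V c' - S U c')" for c'
      unfolding ord_ge_def using UV by (auto simp: S_def x deg_def)
    note o = this
    have "subst f (S V True) (S V False) $ i $ j - subst f (S U True) (S U False) $ i $ j
          = a * (S V True - S U True) $ i $ j + 0 * (S V False - S U False) $ i $ j"
      "subst g (S V True) (S V False) $ i $ j - subst g (S U True) (S U False) $ i $ j
          = 0 * (S V True - S U True) $ i $ j + b * (S V False - S U False) $ i $ j" if "i + j > 0"
      using subst_perturb[OF fg(1) S1 S1 o S1 S1 o that order.refl]
        subst_perturb[OF fg(2) S1 S1 o S1 S1 o that order.refl] by simp_all
    then show "D V x - D U x = d x * (V x - U x)"
      by (cases "i + j = 0"; cases c) (auto simp: D_def d_def x S_def)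
  qed (use assms in \<open>auto simp: d_def split: prod.split\<close>)
  then obtain U where U: "\<And>c i j. D U (c, i, j) = 0" by auto
  define u v where "u = S U True" and "v = S U False"
  have uv: "ord_ge (Suc 0) u" "ord_ge (Suc 0) v" by (simp_all add: u_def v_def S1)
  have z: "ord_ge (Suc 0) (subst f u v)" "ord_ge (Suc 0) (subst g u v)"
    using diag_linear_no_const[OF assms(1)] by (auto simp: no_const_def f_def g_def intro: ord_ge_subst)
  have 1: "subst f u v = serX"
  proof (rule ser_eqI)
    fix i j show "subst f u v $ i $ j = serX $ i $ j"
      using U[of True i j] ord_geD[OF z(1), of i j]
      by (cases "i + j = 0") (auto simp: D_def u_def v_def serX_nth)
  qed
  have 2: "subst g u v = serY"
  proof (rule ser_eqI)
    fix i j show "subst g u v $ i $ j = serY $ i $ j"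
      using U[of False i j] ord_geD[OF z(2), of i j]
      by (cases "i + j = 0") (auto simp: D_def u_def v_def serY_nth)
  qed
  \<comment> \<open>By \<open>subst_linear_part\<close> the series \<open>serX - Cst a * u\<close>
    has order 2; scaling it by \<open>-1 / a\<close> exposes the linear part of \<open>u\<close>.
    The same is done for \<open>v\<close>.\<close>
  have "Cst (-1 / a) * (serX - Cst a * u) = u - Cst (1 / a) * serX"
     "Cst (-1 / b) * (serY - Cst b * v) = v - Cst (1 / b) * serY"
    by (rule ser_eqI, simp only: Cst_mult_nth fps_sub_nth, simp add: assms field_simps)+
  then have "diag_linear (1 / a) (1 / b) (u, v)"
    using subst_linear_part[OF fg(1) uv] subst_linear_part[OF fg(2) uv]
      ord_ge_Cst_mult[of 2 "serX - Cst a * u" "-1/a"] ord_ge_Cst_mult[of 2 "serY - Cst b * v" "-1/b"]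
    by (simp add: 1 2 diag_linear_def)
  moreover have "\<Phi> \<odot> (u, v) = id_map" using 1 2 by (simp add: mcomp_def id_map_def f_def g_def)
  ultimately show ?thesis by blast
qed

text \<open>The right inverse \<open>\<Psi>\<close> has a right inverse \<open>\<Omega>\<close> of
  its own, and associativity gives \<open>\<Omega> = \<Phi>\<close>.\<close>

lemma inverse_exists:
  assumes "diag_linear a b \<Phi>" "a \<noteq> 0" "b \<noteq> 0"
  obtains \<Psi> where "diag_linear (1 / a) (1 / b) \<Psi>" "\<Phi> \<odot> \<Psi> = id_map" "\<Psi> \<odot> \<Phi> = id_map"
proof -
  obtain \<Psi> where \<Psi>: "diag_linear (1 / a) (1 / b) \<Psi>" "\<Phi> \<odot> \<Psi> = id_map" using right_inverse_exists[OF assms] by blast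
  obtain \<Omega> where \<Omega>: "diag_linear a b \<Omega>" "\<Psi> \<odot> \<Omega> = id_map"
    using right_inverse_exists[OF \<Psi>(1)] assms by auto
  note z = diag_linear_no_const[OF \<Psi>(1)] diag_linear_no_const[OF \<Omega>(1)]
  have "\<Phi> = \<Phi> \<odot> (\<Psi> \<odot> \<Omega>)" by (simp add: \<Omega> mcomp_id_map)
  also have "\<dots> = \<Omega>" using \<Psi>(2) z by (simp add: mcomp_assoc[symmetric] id_map_mcomp)
  finally show ?thesis using \<Psi> \<Omega> that by blast
qed

section \<open>Normalized conjugation to a resonant map\<close>

text \<open>Following a conjugation by an invertible resonant map again leads to a resonant map;
  excluding resonant terms beyond the linear ones removes this freedom.\<close>

definition normalized :: "ser_pair \<Rightarrow> bool" where
  "normalized \<Phi> \<longleftrightarrow> diag_linear 1 1 \<Phi> \<and> (\<forall>j>0. fst \<Phi> $ Suc j $ j = 0) \<and> (\<forall>i>0. snd \<Phi> $ i $ Suc i = 0)"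

text \<open>If \<open>mu = 1 / lam\<close> and \<open>lam\<close> is not a root of unity, these are
  the monomials that commute with the linear map \<open>(lam \<xi>, mu \<eta>)\<close>.\<close>

definition resonant :: "ser_pair \<Rightarrow> bool" where
  "resonant N \<longleftrightarrow> (\<forall>i j. i \<noteq> Suc j \<longrightarrow> fst N $ i $ j = 0) \<and> (\<forall>i j. j \<noteq> Suc i \<longrightarrow> snd N $ i $ j = 0)"

text \<open>\<open>F\<close> is one component of the transformation and \<open>M\<close> the
  matching component of the target map. Up to degree \<open>n\<close> the defect of the conjugacy
  equation changes through linear parts only; for \<open>F = f\<close>, \<open>a = lam\<close>,
  \<open>b = 0\<close> the coefficient of \<open>f\<close> acquires the factor
  \<open>lam ^ i * mu ^ j - lam\<close>.\<close>

lemma conj_defect_diff: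
  assumes "ord_ge 2 (P - Cst lam * serX)" "ord_ge 2 (Q - Cst mu * serY)"
    and M: "ord_ge 2 (M - (Cst a * serX + Cst b * serY))"
    and F: "ord_ge n (F' - F)" and M': "ord_ge n (M' - M)"
    and d: "diag_linear 1 1 (f, g)" "diag_linear 1 1 (f', g')" and fg: "ord_ge n (f' - f)" "ord_ge n (g' - g)"
    and n: "n > 0" "i + j \<le> n"
  shows "(subst F' P Q - subst M' f' g') $ i $ j - (subst F P Q - subst M f g) $ i $ j
     = lam ^ i * mu ^ j * (F' - F) $ i $ j - (M' - M) $ i $ j - (a * (f' - f) $ i $ j + b * (g' - g) $ i $ j)"
proof -
  have z: "ord_ge (Suc 0) f" "ord_ge (Suc 0) g" "ord_ge (Suc 0) f'" "ord_ge (Suc 0) g'"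
    using d[THEN diag_linear_no_const] by (auto simp: no_const_def)
  have "subst (F' - F) P Q $ i $ j = lam ^ i * mu ^ j * (F' - F) $ i $ j"
    by (rule subst_leading[OF F assms(1,2) n(2)])
  moreover have "subst (M' - M) f' g' $ i $ j = 1 ^ i * 1 ^ j * (M' - M) $ i $ j"
    using d(2) by (intro subst_leading[OF M' _ _ n(2)]) (auto simp: diag_linear_def)
  moreover have "subst M f' g' $ i $ j - subst M f g $ i $ j = a * (f' - f) $ i $ j + b * (g' - g) $ i $ j"
    by (intro subst_perturb[OF M _ _ fg(1) _ _ fg(2) n] z)
  moreover have "(subst F' P Q - subst M' f' g') $ i $ j - (subst F P Q - subst M f g) $ i $ j
      = subst (F' - F) P Q $ i $ j - subst (M' - M) f' g' $ i $ j
        - (subst M f' g' $ i $ j - subst M f g $ i $ j)"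
    by (simp add: subst_diff)
  ultimately show ?thesis by (simp only: power_one mult_1_left)
qed

text \<open>As \<open>mu = 1 / lam\<close>, both equations compare two powers of \<open>lam\<close>,
  and distinct powers differ because \<open>lam\<close> is not a root of unity.\<close>

lemma nonresonance:
  fixes lam mu :: complex
  assumes "lam * mu = 1" "\<forall>n>0. lam ^ n \<noteq> 1"
  shows "lam ^ i * mu ^ j = lam \<longleftrightarrow> i = Suc j" "lam ^ i * mu ^ j = mu \<longleftrightarrow> j = Suc i"
proof -
  have lm: "lam \<noteq> 0" "mu = 1 / lam" using assms(1) by (auto simp: eq_divide_eq mult.commute)
  have inj: "lam ^ m = lam ^ n \<longleftrightarrow> m = n" for m n
  proof
    assume eq: "lam ^ m = lam ^ n"
    show "m = n"
    proof (rule ccontr)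
      assume "m \<noteq> n"
      define k where "k = max m n - min m n"
      have "lam ^ max m n = lam ^ min m n" using eq by (auto simp: max_def min_def)
      moreover have "lam ^ max m n = lam ^ min m n * lam ^ k"
        by (simp add: k_def flip: power_add)
      ultimately have "lam ^ k = 1" using lm by simp
      moreover have "k > 0" using \<open>m \<noteq> n\<close> by (auto simp: k_def max_def min_def)
      ultimately show False using assms(2) by blast
    qed
  qed auto
  have "lam ^ i * mu ^ j = lam \<longleftrightarrow> lam ^ i = lam ^ Suc j"
    unfolding lm(2) using lm(1) by (simp add: field_simps)
  then show "lam ^ i * mu ^ j = lam \<longleftrightarrow> i = Suc j" by (simp only: inj)
  have "lam ^ i * mu ^ j = mu \<longleftrightarrow> lam ^ j = lam ^ Suc i"
    unfolding lm(2) using lm(1) by (auto simp: field_simps)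
  then show "lam ^ i * mu ^ j = mu \<longleftrightarrow> j = Suc i" by (simp only: inj)
qed

text \<open>Each position carries one unknown: a coefficient of \<open>N\<close> where it is
  resonant, of \<open>\<Phi>\<close> elsewhere. Its factor is \<open>-1\<close> in the first case
  and a difference of eigenvalues, nonzero by \<open>nonresonance\<close>, in the second, so
  \<open>triangular_solution\<close> applies.\<close>

lemma resonant_conjugation_exists:
  assumes lm: "lam * mu = 1" "\<forall>n>0. lam ^ n \<noteq> 1" and \<phi>: "diag_linear lam mu \<phi>"
  shows "\<exists>\<Phi> N. normalized \<Phi> \<and> resonant N \<and> diag_linear lam mu N \<and> \<Phi> \<odot> \<phi> = N \<odot> \<Phi>"
proof -
  define res where "res = (\<lambda>(c, i, j). if c then i = Suc j else j = Suc i)"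
  \<comment> \<open>The flag \<open>r\<close> distributes the unknowns: \<open>S True\<close>
    collects the resonant ones for the target map, \<open>S False\<close> the others for the
    transformation.\<close>
  define S where "S r U c = ser (\<lambda>i j. if 2 \<le> i + j \<and> res (c, i, j) = r then U (c, i, j) else 0)"
    for r and U :: "bool \<times> nat \<times> nat \<Rightarrow> complex" and c
  define f g M K where "f U = serX + S False U True" and "g U = serY + S False U False"
    and "M U = Cst lam * serX + S True U True" and "K U = Cst mu * serY + S True U False" for U
  define P Q where "P = fst \<phi>" and "Q = snd \<phi>"
  \<comment> \<open>Below degree 2 all coefficients of the two maps are prescribed, so the equation
    there just sets a placeholder to zero.\<close>
  define D where "D U = (\<lambda>(c, i, j). if i + j < 2 then U (c, i, j) else
      if c then (subst (f U) P Q - subst (M U) (f U) (g U)) $ i $ j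
      else (subst (g U) P Q - subst (K U) (f U) (g U)) $ i $ j)" for U
  define d where "d = (\<lambda>(c, i, j). if i + j < 2 then 1 else if res (c, i, j) then -1
      else lam ^ i * mu ^ j - (if c then lam else mu))"
  define deg where "deg = (\<lambda>(c :: bool, i :: nat, j). i + j)"
  have PQ: "ord_ge 2 (P - Cst lam * serX)" "ord_ge 2 (Q - Cst mu * serY)"
    using \<phi> by (simp_all add: diag_linear_def P_def Q_def)
  have S2: "ord_ge 2 (S r U c)" for r U c by (simp add: S_def ord_ge_def)
  have MK: "ord_ge 2 (M U - (Cst lam * serX + Cst 0 * serY))" "ord_ge 2 (K U - (Cst 0 * serX + Cst mu * serY))" for U
    by (simp_all add: M_def K_def S2)
  have fg: "diag_linear 1 1 (f U, g U)" for U by (simp add: f_def g_def diag_linear_def S2)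
  have "\<exists>U. \<forall>x. D U x = 0"
  proof (rule triangular_solution)
    fix U V :: "bool \<times> nat \<times> nat \<Rightarrow> complex" and x assume UV: "\<And>y. deg y < deg x \<Longrightarrow> U y = V y"
    obtain c i j where x: "x = (c, i, j)" by (cases x)
    show "D V x - D U x = d x * (V x - U x)"
    proof (cases "i + j < 2")
      case True then show ?thesis by (simp add: D_def d_def x)
    next
      case False
      have "ord_ge (i + j) (S r V c' - S r U c')" for c' r
        unfolding ord_ge_def using UV by (auto simp: S_def x deg_def)
      then have o: "ord_ge (i + j) (f V - f U)" "ord_ge (i + j) (g V - g U)"
        "ord_ge (i + j) (M V - M U)" "ord_ge (i + j) (K V - K U)"
        by (simp_all add: f_def g_def M_def K_def)
      have n: "i + j > 0" using False by linarith
      note 1 = conj_defect_diff[OF PQ MK(1) o(1) o(3) fg fg o(1,2) n order.refl]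
      note 2 = conj_defect_diff[OF PQ MK(2) o(2) o(4) fg fg o(1,2) n order.refl]
      define \<delta> where "\<delta> c = V (c, i, j) - U (c, i, j)" for c
      have df: "(f V - f U) $ i $ j = (if res (True, i, j) then 0 else \<delta> True)"
        "(g V - g U) $ i $ j = (if res (False, i, j) then 0 else \<delta> False)"
        "(M V - M U) $ i $ j = (if res (True, i, j) then \<delta> True else 0)"
        "(K V - K U) $ i $ j = (if res (False, i, j) then \<delta> False else 0)"
        using False by (simp_all add: f_def g_def M_def K_def S_def \<delta>_def)
      have "D V (c, i, j) - D U (c, i, j) = d (c, i, j) * \<delta> c"
        using 1 2 False unfolding df
        by (cases c; cases "res (c, i, j)") (simp_all add: D_def d_def left_diff_distrib)
      then show ?thesis by (simp add: x \<delta>_def)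
    qed
  next
    show "d x \<noteq> 0" for x
      using nonresonance[OF lm] by (auto simp: d_def res_def split: prod.splits)
  qed
  then obtain U where U: "\<And>c i j. D U (c, i, j) = 0" by auto
  have N: "diag_linear lam mu (M U, K U)" using MK[of U] by (simp add: diag_linear_def)
  have eq: "(f U, g U) \<odot> \<phi> = (M U, K U) \<odot> (f U, g U)"
  proof (rule diag_linear_eqI)
    show "diag_linear lam mu ((f U, g U) \<odot> \<phi>)" "diag_linear lam mu ((M U, K U) \<odot> (f U, g U))"
      using diag_linear_mcomp[OF fg \<phi>, of U] diag_linear_mcomp[OF N fg, of U] by simp_all
    fix i j :: nat assume "2 \<le> i + j"
    then show "fst ((f U, g U) \<odot> \<phi>) $ i $ j = fst ((M U, K U) \<odot> (f U, g U)) $ i $ j"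
      "snd ((f U, g U) \<odot> \<phi>) $ i $ j = snd ((M U, K U) \<odot> (f U, g U)) $ i $ j"
      using U[of True i j] U[of False i j] by (simp_all add: D_def mcomp_def P_def Q_def)
  qed
  have "normalized (f U, g U)"
    unfolding normalized_def using fg[of U]
    by (auto simp: f_def g_def S_def res_def serX_nth serY_nth)
  moreover have "resonant (M U, K U)"
    by (auto simp: resonant_def M_def K_def S_def res_def serX_nth serY_nth)
  ultimately show ?thesis using N eq by blast
qed

text \<open>The differences of two solutions vanish by induction on the degree. At a resonant
  position normalization annihilates the transformation part and the equation the rest; elsewhere
  the target maps have no term and the eigenvalue difference is invertible.\<close>

lemma resonant_conjugation_unique:
  assumes lm: "lam * mu = 1" "\<forall>n>0. lam ^ n \<noteq> 1" and \<phi>: "diag_linear lam mu \<phi>"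
    and 1: "normalized \<Phi>" "resonant N" "diag_linear lam mu N" "\<Phi> \<odot> \<phi> = N \<odot> \<Phi>"
    and 2: "normalized \<Phi>'" "resonant N'" "diag_linear lam mu N'" "\<Phi>' \<odot> \<phi> = N' \<odot> \<Phi>'"
  shows "\<Phi>' = \<Phi> \<and> N' = N"
proof -
  obtain f g f' g' M K M' K' P Q where p: "\<Phi> = (f, g)" "\<Phi>' = (f', g')" "N = (M, K)" "N' = (M', K')" "\<phi> = (P, Q)"
    by (cases \<Phi>; cases \<Phi>'; cases N; cases N'; cases \<phi>)
  have PQ: "ord_ge 2 (P - Cst lam * serX)" "ord_ge 2 (Q - Cst mu * serY)"
    using \<phi> by (simp_all add: diag_linear_def p)
  have MK: "ord_ge 2 (M - (Cst lam * serX + Cst 0 * serY))" "ord_ge 2 (K - (Cst 0 * serX + Cst mu * serY))"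
    using 1 by (simp_all add: diag_linear_def p)
  have d: "diag_linear 1 1 (f, g)" "diag_linear 1 1 (f', g')" using 1 2 by (simp_all add: normalized_def p)
  have o: "ord_ge n (f' - f) \<and> ord_ge n (g' - g) \<and> ord_ge n (M' - M) \<and> ord_ge n (K' - K)" for n
  proof (induction n)
    case 0 then show ?case by simp
  next
    case (Suc n)
    have "(f' - f) $ i $ j = 0 \<and> (g' - g) $ i $ j = 0 \<and> (M' - M) $ i $ j = 0 \<and> (K' - K) $ i $ j = 0"
      if ij: "i + j = n" for i j
    proof (cases "n < 2")
      case True
      with d 1(3) 2(3) ij show ?thesis by (auto simp: diag_linear_def ord_ge_def p)
    next
      case False
      have eq: "subst f P Q = subst M f g" "subst f' P Q = subst M' f' g'"
         "subst g P Q = subst K f g" "subst g' P Q = subst K' f' g'"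
        using 1(4) 2(4) by (simp_all add: p mcomp_def)
      have e1: "lam ^ i * mu ^ j * (f' - f) $ i $ j - (M' - M) $ i $ j = lam * (f' - f) $ i $ j"
        using conj_defect_diff[OF PQ MK(1) _ _ d, of n f' f M' i j] Suc False ij eq by simp
      have e2: "lam ^ i * mu ^ j * (g' - g) $ i $ j - (K' - K) $ i $ j = mu * (g' - g) $ i $ j"
        using conj_defect_diff[OF PQ MK(2) _ _ d, of n g' g K' i j] Suc False ij eq by simp
      have "(f' - f) $ i $ j = 0 \<and> (M' - M) $ i $ j = 0"
      proof (cases "i = Suc j")
        case True
        then have "(f' - f) $ i $ j = 0" using 1(1) 2(1) False ij by (auto simp: normalized_def p)
        with e1 show ?thesis by simp
      next
        case False
        then have m: "(M' - M) $ i $ j = 0" using 1(2) 2(2) by (auto simp: resonant_def p)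
        then have "(lam ^ i * mu ^ j - lam) * (f' - f) $ i $ j = 0"
          using e1 by (simp only: left_diff_distrib) simp
        then show ?thesis using m False nonresonance(1)[OF lm, of i j] by auto
      qed
      moreover have "(g' - g) $ i $ j = 0 \<and> (K' - K) $ i $ j = 0"
      proof (cases "j = Suc i")
        case True
        then have "(g' - g) $ i $ j = 0" using 1(1) 2(1) False ij by (auto simp: normalized_def p)
        with e2 show ?thesis by simp
      next
        case False
        then have m: "(K' - K) $ i $ j = 0" using 1(2) 2(2) by (auto simp: resonant_def p)
        then have "(lam ^ i * mu ^ j - mu) * (g' - g) $ i $ j = 0"
          using e2 by (simp only: left_diff_distrib) simp
        then show ?thesis using m False nonresonance(2)[OF lm, of i j] by auto
      qed
      ultimately show ?thesis by blast
    qed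
    with Suc show ?case unfolding ord_ge_def less_Suc_eq by blast
  qed
  have "H $ i $ j = G $ i $ j" if "\<And>n. ord_ge n (H - G)" for H G i j
    using that[of "Suc (i + j)"] by (auto simp: ord_ge_def)
  then have "H = G" if "\<And>n. ord_ge n (H - G)" for H G using that by (blast intro: ser_eqI)
  then show ?thesis using o by (simp add: p)
qed

section \<open>Reality and reversibility\<close>

text \<open>The properties shared by the identity and complex conjugation, so that one set of lemmas
  serves both \<open>\<tau>\<close> and \<open>\<rho>\<close>.\<close>

definition cxhom :: "(complex \<Rightarrow> complex) \<Rightarrow> bool" where
  "cxhom c \<longleftrightarrow> (\<forall>x y. c (x + y) = c x + c y) \<and> (\<forall>x y. c (x * y) = c x * c y) \<and> c 1 = 1"

lemma cxhom_id: "cxhom (\<lambda>x. x)" and cxhom_cnj: "cxhom cnj"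
  by (simp_all add: cxhom_def)

lemma cxhomD: "cxhom c \<Longrightarrow> c (x + y) = c x + c y" "cxhom c \<Longrightarrow> c (x * y) = c x * c y"
  "cxhom c \<Longrightarrow> c 1 = 1" "cxhom c \<Longrightarrow> c 0 = 0"
proof -
  assume c: "cxhom c"
  then have "c (0 + 0) = c 0 + c 0" unfolding cxhom_def by blast
  then show "c 0 = 0" by simp
qed (auto simp: cxhom_def)

lemma cxhom_diff: "cxhom c \<Longrightarrow> c (x - y) = c x - c y"
  using cxhomD(1)[of c "x - y" y] by simp

lemma cxhom_sum: "cxhom c \<Longrightarrow> c (sum f A) = (\<Sum>a\<in>A. c (f a))"
  by (induction A rule: infinite_finite_induct) (simp_all add: cxhomD)

text \<open>Conjugation by \<open>\<tau>\<close> corresponds to \<open>c = (\<lambda>x. x)\<close>, conjugation by \<open>\<rho>\<close> to \<open>c = cnj\<close>.\<close>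
definition flip :: "(complex \<Rightarrow> complex) \<Rightarrow> ser \<Rightarrow> ser" where
  "flip c F = ser (\<lambda>i j. c (F $ j $ i))"

lemma flip_nth [simp]: "flip c F $ i $ j = c (F $ j $ i)" by (simp add: flip_def)

lemma flip_mult: assumes "cxhom c" shows "flip c (F * G) = flip c F * flip c G"
proof (rule ser_eqI)
  fix i j
  have "flip c (F * G) $ i $ j = (\<Sum>k\<le>j. \<Sum>l\<le>i. c (F $ k $ l) * c (G $ (j - k) $ (i - l)))"
    using assms by (simp add: ser_mult_nth cxhom_sum cxhomD)
  also have "\<dots> = (\<Sum>l\<le>i. \<Sum>k\<le>j. c (F $ k $ l) * c (G $ (j - k) $ (i - l)))" by (rule sum.swap)
  finally show "flip c (F * G) $ i $ j = (flip c F * flip c G) $ i $ j" by (simp add: ser_mult_nth)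
qed

lemma flip_power: "cxhom c \<Longrightarrow> flip c (F ^ n) = flip c F ^ n"
  by (induction n) (auto simp: flip_mult cxhomD intro!: ser_eqI)

lemma flip_diff: "cxhom c \<Longrightarrow> flip c (F - G) = flip c F - flip c G"
  by (rule ser_eqI) (simp add: cxhom_diff)

lemma flip_Cst_mult: "cxhom c \<Longrightarrow> flip c (Cst a * F) = Cst (c a) * flip c F"
  by (rule ser_eqI) (simp add: cxhomD)

lemma flip_XY: "cxhom c \<Longrightarrow> flip c serX = serY" "cxhom c \<Longrightarrow> flip c serY = serX"
  by (auto intro!: ser_eqI simp: serX_nth serY_nth cxhomD)

lemma ord_ge_flip: "cxhom c \<Longrightarrow> ord_ge n F \<Longrightarrow> ord_ge n (flip c F)"
  by (simp add: ord_ge_def cxhomD add.commute)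

text \<open>Transposition exchanges the variables, so the transposed \<open>F\<close> takes its
  arguments in the opposite order; multiplicativity carries \<open>flip c\<close> through the
  powers.\<close>

lemma flip_subst:
  assumes c: "cxhom c" and "ord_ge (Suc 0) f" "ord_ge (Suc 0) g"
  shows "flip c (subst F f g) = subst (flip c F) (flip c g) (flip c f)"
proof (rule ser_eqI)
  fix i j :: nat
  have "flip c (subst F f g) $ i $ j
      = (\<Sum>k\<le>i+j. \<Sum>l\<le>i+j. c (F $ k $ l) * flip c (f ^ k * g ^ l) $ i $ j)"
    using subst_nth_box[OF assms(2,3), of j i "i + j" F] c by (simp add: cxhom_sum cxhomD)
  also have "\<dots> = (\<Sum>l\<le>i+j. \<Sum>k\<le>i+j. c (F $ k $ l) * flip c (f ^ k * g ^ l) $ i $ j)" by (rule sum.swap)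
  also have "\<dots> = subst (flip c F) (flip c g) (flip c f) $ i $ j"
    using assms by (simp add: subst_nth_box[where N = "i + j"] ord_ge_flip flip_mult flip_power mult.commute
       del: flip_nth) simp
  finally show "flip c (subst F f g) $ i $ j = subst (flip c F) (flip c g) (flip c f) $ i $ j" .
qed

definition mflip :: "(complex \<Rightarrow> complex) \<Rightarrow> ser_pair \<Rightarrow> ser_pair" where
  "mflip c \<Phi> = (flip c (snd \<Phi>), flip c (fst \<Phi>))"

lemma mflip_mcomp: "cxhom c \<Longrightarrow> no_const \<Psi> \<Longrightarrow> mflip c (\<Phi> \<odot> \<Psi>) = mflip c \<Phi> \<odot> mflip c \<Psi>"
  by (simp add: mflip_def mcomp_def no_const_def flip_subst)

lemma mflip_id_map: "cxhom c \<Longrightarrow> mflip c id_map = id_map"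
  by (simp add: mflip_def id_map_def flip_XY)

lemma diag_linear_mflip: assumes "cxhom c" "diag_linear a b \<Phi>" shows "diag_linear (c b) (c a) (mflip c \<Phi>)"
proof -
  have "ord_ge 2 (flip c (fst \<Phi> - Cst a * serX))" "ord_ge 2 (flip c (snd \<Phi> - Cst b * serY))"
    using assms by (simp_all add: diag_linear_def ord_ge_flip)
  then show ?thesis using assms(1) by (simp add: diag_linear_def mflip_def flip_diff flip_Cst_mult flip_XY)
qed

lemma normalized_mflip: assumes "cxhom c" "normalized \<Phi>" shows "normalized (mflip c \<Phi>)"
  using assms diag_linear_mflip[OF assms(1), of 1 1 \<Phi>]
  by (simp add: normalized_def mflip_def cxhomD)

lemma resonant_mflip: assumes "cxhom c" "resonant N" shows "resonant (mflip c N)"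
  using assms by (simp add: resonant_def mflip_def cxhomD)

section \<open>Symmetries of the normalized conjugation\<close>

lemma subst_Cst_mult_linear:
  "ord_ge (Suc 0) f \<Longrightarrow> ord_ge (Suc 0) g \<Longrightarrow> subst (Cst a * serX) f g = Cst a * f"
  "ord_ge (Suc 0) f \<Longrightarrow> ord_ge (Suc 0) g \<Longrightarrow> subst (Cst a * serY) f g = Cst a * g"
  by (simp_all add: subst_Cst_mult)

text \<open>The linear map multiplies coefficients by \<open>lam ^ i * mu ^ j\<close> when composed
  on the right and by \<open>lam\<close> or \<open>mu\<close> on the left. Commutation is the form
  of resonance that passes directly to inverses.\<close>

lemma resonant_iff_commutes:
  assumes "lam * mu = 1" "\<forall>n>0. lam ^ n \<noteq> 1" and z: "no_const N"
  shows "resonant N \<longleftrightarrow> N \<odot> (Cst lam * serX, Cst mu * serY) = (Cst lam * serX, Cst mu * serY) \<odot> N"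
proof -
  have "x * a = x * b \<longleftrightarrow> a = b \<or> x = 0" for x a b :: complex by auto
  then have "N \<odot> (Cst lam * serX, Cst mu * serY) = (Cst lam * serX, Cst mu * serY) \<odot> N
    \<longleftrightarrow> (\<forall>i j. lam ^ i * mu ^ j = lam \<or> fst N $ i $ j = 0) \<and> (\<forall>i j. lam ^ i * mu ^ j = mu \<or> snd N $ i $ j = 0)"
    using z by (simp add: mcomp_def no_const_def subst_Cst_mult_linear ser_eq_iff subst_linear_nth)
  then show ?thesis by (auto simp: resonant_def nonresonance[OF assms(1,2)])
qed

text \<open>Each symmetry carries a normalized solution of the conjugacy equation to another one, so
  the normalized solution inherits it.\<close>

lemma normalized_conjugation_real:
  assumes lm: "lam * mu = 1" "\<forall>n>0. lam ^ n \<noteq> 1" "cnj lam = mu" and \<phi>: "diag_linear lam mu \<phi>"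
    and real: "mflip cnj \<phi> = \<phi>"
    and 1: "normalized \<Phi>" "resonant N" "diag_linear lam mu N" "\<Phi> \<odot> \<phi> = N \<odot> \<Phi>"
  shows "mflip cnj \<Phi> = \<Phi> \<and> mflip cnj N = N"
proof (rule resonant_conjugation_unique[OF lm(1,2) \<phi> 1])
  have z: "no_const \<phi>" "no_const \<Phi>" using diag_linear_no_const[OF \<phi>] diag_linear_no_const[of 1 1 \<Phi>] 1(1) by (auto simp: normalized_def)
  show "normalized (mflip cnj \<Phi>)" "resonant (mflip cnj N)"
    using 1 by (simp_all add: normalized_mflip resonant_mflip cxhom_cnj)
  show "diag_linear lam mu (mflip cnj N)" using diag_linear_mflip[OF cxhom_cnj 1(3)] lm(3) by auto
  show "mflip cnj \<Phi> \<odot> \<phi> = mflip cnj N \<odot> mflip cnj \<Phi>"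
    using arg_cong[OF 1(4), of "mflip cnj"] z by (simp add: mflip_mcomp cxhom_cnj real)
qed

text \<open>Conjugation by \<open>\<tau>\<close> turns \<open>\<phi>\<close> into its inverse.
  Inverting the transformed equation, the flipped \<open>\<Phi>\<close> conjugates
  \<open>\<phi>\<close> to the inverse \<open>K\<close> of the flipped \<open>N\<close>; uniqueness
  then gives both claims.\<close>

lemma normalized_conjugation_reversible:
  assumes lm: "lam * mu = 1" "\<forall>n>0. lam ^ n \<noteq> 1" and \<phi>: "diag_linear lam mu \<phi>"
    and rev: "mflip (\<lambda>x. x) \<phi> \<odot> \<phi> = id_map"
    and 1: "normalized \<Phi>" "resonant N" "diag_linear lam mu N" "\<Phi> \<odot> \<phi> = N \<odot> \<Phi>"
  shows "mflip (\<lambda>x. x) \<Phi> = \<Phi> \<and> N \<odot> mflip (\<lambda>x. x) N = id_map"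
proof -
  let ?t = "mflip (\<lambda>x. x)" and ?L = "(Cst lam * serX, Cst mu * serY)"
  have lm0: "lam \<noteq> 0" "mu \<noteq> 0" using lm(1) by auto
  have inv: "1 / mu = lam" "1 / lam = mu" using lm0 lm(1) by (simp_all add: divide_eq_eq mult.commute)
  have tN: "diag_linear mu lam (?t N)" using diag_linear_mflip[OF cxhom_id 1(3)] by simp
  then obtain K where K: "diag_linear lam mu K" "?t N \<odot> K = id_map" "K \<odot> ?t N = id_map"
    using inverse_exists[OF tN lm0(2,1)] inv by metis
  have \<Phi>: "diag_linear 1 1 \<Phi>" "diag_linear 1 1 (?t \<Phi>)" using 1(1) normalized_mflip[OF cxhom_id] by (auto simp: normalized_def)
  have L: "no_const ?L" by (simp add: no_const_def ord_ge_linear)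
  note z = diag_linear_no_const[OF tN] diag_linear_no_const[OF K(1)] diag_linear_no_const[OF \<Phi>(1)] diag_linear_no_const[OF \<Phi>(2)] diag_linear_no_const[OF \<phi>] L
  have "resonant (?t N)" using 1 by (simp add: resonant_mflip cxhom_id)
  then have comm: "?t N \<odot> ?L = ?L \<odot> ?t N" using resonant_iff_commutes[OF lm] z by blast
  \<comment> \<open>The inverse of a map commuting with \<open>?L\<close> commutes with
    \<open>?L\<close> as well, so \<open>K\<close> is resonant.\<close>
  have "K \<odot> ?L = K \<odot> (?L \<odot> (?t N \<odot> K))" by (simp add: K mcomp_id_map)
  also have "\<dots> = K \<odot> (?L \<odot> ?t N) \<odot> K" using z by (simp add: mcomp_assoc no_const_mcomp)
  also have "\<dots> = K \<odot> (?t N \<odot> ?L) \<odot> K" by (simp add: comm)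
  also have "\<dots> = (K \<odot> ?t N) \<odot> (?L \<odot> K)" using z by (simp add: mcomp_assoc no_const_mcomp)
  also have "\<dots> = ?L \<odot> K" using z by (simp add: K id_map_mcomp no_const_mcomp)
  finally have resK: "resonant K" using resonant_iff_commutes[OF lm] z by blast
  have "?t \<Phi> \<odot> ?t \<phi> = ?t N \<odot> ?t \<Phi>"
    using arg_cong[OF 1(4), of ?t] z by (simp add: mflip_mcomp cxhom_id)
  \<comment> \<open>Composing with \<open>\<phi>\<close> on the right cancels
    \<open>?t \<phi>\<close> by reversibility.\<close>
  then have "(?t \<Phi> \<odot> ?t \<phi>) \<odot> \<phi> = (?t N \<odot> ?t \<Phi>) \<odot> \<phi>" by simp
  moreover have "no_const (?t \<phi>)" using diag_linear_no_const[OF diag_linear_mflip[OF cxhom_id \<phi>]] .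
  ultimately have "?t \<Phi> = ?t N \<odot> (?t \<Phi> \<odot> \<phi>)"
    using z rev by (simp add: mcomp_assoc mcomp_id_map)
  then have "K \<odot> ?t \<Phi> = K \<odot> (?t N \<odot> (?t \<Phi> \<odot> \<phi>))" by simp
  also have "\<dots> = ?t \<Phi> \<odot> \<phi>" using z by (simp add: mcomp_assoc[of "?t N" "?t \<Phi> \<odot> \<phi>" K, symmetric] K(3) id_map_mcomp no_const_mcomp)
  finally have "?t \<Phi> \<odot> \<phi> = K \<odot> ?t \<Phi>" ..
  moreover have "normalized (?t \<Phi>)" using 1 by (simp add: normalized_mflip cxhom_id)
  ultimately have "?t \<Phi> = \<Phi> \<and> K = N"
    using resonant_conjugation_unique[OF lm \<phi> 1] resK K(1) by blast
  with K(3) show ?thesis by simp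
qed

section \<open>Resonant maps\<close>

text \<open>The value of \<open>h\<close> at the product \<open>serX * serY\<close>; series of this
  kind are the coefficients of resonant maps.\<close>

definition emb :: "complex fps \<Rightarrow> ser" where
  "emb h = ser (\<lambda>i j. if i = j then h $ i else 0)"

lemma emb_nth: "emb h $ i $ j = (if i = j then h $ i else 0)" by (simp add: emb_def)

lemma emb_inj: "emb h = emb k \<longleftrightarrow> h = k"
  by (auto simp: ser_eq_iff emb_nth fps_eq_iff)

lemma emb_1 [simp]: "emb 1 = 1"
  by (rule ser_eqI) (simp add: emb_nth)

lemma emb_X: "emb fps_X = serX * serY"
  by (rule ser_eqI) (auto simp: emb_nth serX_mult_nth serY_nth fps_X_def)

lemma emb_const: "emb (fps_const c) = Cst c"
  by (rule ser_eqI) (auto simp: emb_nth Cst_nth)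

lemma emb_mult: "emb (h * k) = emb h * emb k"
proof (rule ser_eqI)
  fix i j
  have "(emb h * emb k) $ i $ j = (\<Sum>m\<le>i. \<Sum>l\<le>j. if l = m then (if i = j then h $ m * k $ (i - m) else 0) else 0)"
    unfolding ser_mult_nth by (intro sum.cong refl) (auto simp: emb_nth)
  also have "\<dots> = (\<Sum>m\<le>i. if i = j then h $ m * k $ (i - m) else 0)"
    by (intro sum.cong refl) auto
  also have "\<dots> = emb (h * k) $ i $ j"
    by (simp add: emb_nth fps_mult_nth atLeast0AtMost)
  finally show "emb (h * k) $ i $ j = (emb h * emb k) $ i $ j" ..
qed

lemma emb_power: "emb (h ^ n) = emb h ^ n"
  by (induction n) (simp_all add: emb_mult)

text \<open>Only equal powers of the two arguments occur, and
  \<open>f ^ m * g ^ m = emb (k ^ m)\<close>.\<close>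

lemma subst_emb:
  assumes "ord_ge (Suc 0) f" "ord_ge (Suc 0) g" and fg: "f * g = emb k" and k: "k $ 0 = 0"
  shows "subst (emb h) f g = emb (h oo k)"
proof (rule ser_eqI)
  fix i j
  have "subst (emb h) f g $ i $ j = (\<Sum>m\<le>i+j. \<Sum>l\<le>i+j. emb h $ m $ l * (f ^ m * g ^ l) $ i $ j)"
    by (rule subst_nth_box[OF assms(1,2) order.refl])
  also have "\<dots> = (\<Sum>m\<le>i+j. \<Sum>l\<le>i+j. if l = m then h $ m * emb (k ^ m) $ i $ j else 0)"
    by (intro sum.cong refl) (auto simp: emb_nth[of h] emb_power fg[symmetric] power_mult_distrib)
  also have "\<dots> = (\<Sum>m\<le>i+j. h $ m * emb (k ^ m) $ i $ j)" by simp
  also have "\<dots> = emb (h oo k) $ i $ j"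
  proof (cases "i = j")
    case True
    \<comment> \<open>Powers \<open>k ^ m\<close> with \<open>m > i\<close> have no term of degree
      \<open>i\<close>, so the longer range adds only zeros.\<close>
    have "(\<Sum>m\<le>i+j. h $ m * (k ^ m) $ i) = (\<Sum>m\<le>i. h $ m * (k ^ m) $ i)"
      using startsby_zero_power_prefix[OF k] by (intro sum.mono_neutral_right) auto
    then show ?thesis using True by (simp add: emb_nth fps_compose_nth atLeast0AtMost)
  qed (simp add: emb_nth)
  finally show "subst (emb h) f g $ i $ j = emb (h oo k) $ i $ j" .
qed

lemma ord_ge_XY_mult: "ord_ge (Suc 0) (serX * F)" "ord_ge (Suc 0) (serY * F)"
  using ord_ge_mult[of 1 serX 0 F] ord_ge_mult[of 1 serY 0 F] by simp_all

lemma resonant_factor: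
  assumes "resonant N"
  obtains \<alpha> \<beta> where "N = (serX * emb \<alpha>, serY * emb \<beta>)"
proof
  show "N = (serX * emb (Abs_fps (\<lambda>n. fst N $ Suc n $ n)), serY * emb (Abs_fps (\<lambda>n. snd N $ n $ Suc n)))"
    using assms by (intro prod_eqI ser_eqI) (auto simp: resonant_def serX_mult_nth serY_mult_nth emb_nth gr0_conv_Suc)
qed

lemma subst_resonant:
  assumes "ord_ge (Suc 0) f" "ord_ge (Suc 0) g" "f * g = emb k" "k $ 0 = 0"
  shows "subst (Cst c * (serX * emb h)) f g = Cst c * (f * emb (h oo k))"
    "subst (Cst c * (serY * emb h)) f g = Cst c * (g * emb (h oo k))"
  using assms by (simp_all add: subst_Cst_mult subst_mult subst_emb)

text \<open>At the first positive degree \<open>n\<close> that might carry a coefficient of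
  \<open>m\<close>, both factors contribute \<open>m $ n\<close>, because \<open>fps_X * m\<close>
  is tangent to the identity. Hence \<open>m $ n + m $ n = 0\<close>.\<close>

lemma involution_trivial:
  fixes m :: "complex fps"
  assumes m0: "m $ 0 = 1" and eq: "m * (m oo (fps_X * m)) = 1"
  shows "m = 1"
proof -
  have "m $ n = 0" if "n > 0" for n
    using that
  proof (induction n rule: less_induct)
    case (less n)
    define c where "c = m oo (fps_X * m)"
    have k0: "(fps_X * m) $ 0 = 0" by simp
    have c: "c $ n = m $ n" and c0: "c $ 0 = 1"
    proof -
      have "c $ n = (\<Sum>i=0..n. if i = n then m $ n else 0)"
        unfolding c_def fps_compose_nth
      proof (intro sum.cong refl)
        fix i assume "i \<in> {0..n}"
        then show "m $ i * ((fps_X * m) ^ i) $ n = (if i = n then m $ n else 0)"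
          using less startsby_zero_power_nth_same[OF k0, of n] m0
          by (cases "i = 0"; cases "i = n") auto
      qed
      then show "c $ n = m $ n" by simp
      show "c $ 0 = 1" by (simp add: c_def m0)
    qed
    have "0 = (m * c) $ n" using eq less.prems by (simp add: c_def)
    also have "\<dots> = (\<Sum>i=0..n. (if i = 0 then m $ n else 0) + (if i = n then m $ n else 0))"
      unfolding fps_mult_nth
    proof (intro sum.cong refl)
      fix i assume "i \<in> {0..n}"
      then show "m $ i * c $ (n - i) = (if i = 0 then m $ n else 0) + (if i = n then m $ n else 0)"
        using less c c0 m0 by (cases "i = 0"; cases "i = n") auto
    qed
    also have "\<dots> = m $ n + m $ n" by (simp add: sum.distrib)
    finally have "m $ n + m $ n = 0" by simp
    then show ?case by (simp flip: mult_2)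
  qed
  then show ?thesis using m0 by (auto simp: fps_eq_iff)
qed

section \<open>Conjugate, real and unimodular series\<close>

definition fcnj :: "complex fps \<Rightarrow> complex fps" where
  "fcnj h = Abs_fps (\<lambda>n. cnj (h $ n))"

lemma fcnj_nth [simp]: "fcnj h $ n = cnj (h $ n)" by (simp add: fcnj_def)

lemma fcnj_mult: "fcnj (h * k) = fcnj h * fcnj k"
  by (simp add: fps_eq_iff fps_mult_nth)

lemma fcnj_fcnj [simp]: "fcnj (fcnj h) = h" by (simp add: fps_eq_iff)

lemma fcnj_1 [simp]: "fcnj 1 = 1" by (simp add: fps_eq_iff)

lemma fcnj_power: "fcnj (h ^ n) = fcnj h ^ n"
  by (induction n) (simp_all add: fcnj_mult)

lemma fcnj_compose: "fcnj (h oo k) = fcnj h oo fcnj k"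
  by (simp add: fps_eq_iff fps_compose_nth flip: fcnj_power)

lemma fcnj_deriv: "fcnj (fps_deriv h) = fps_deriv (fcnj h)"
  by (simp add: fps_eq_iff)

lemma fcnj_exp: "fcnj (fps_exp 1) = fps_exp 1"
  by (simp add: fps_eq_iff)

text \<open>Keeping real series in a type of their own makes radicals built on the real
  \<open>root\<close> available.\<close>

definition cplx :: "real fps \<Rightarrow> complex fps" where
  "cplx h = Abs_fps (\<lambda>n. of_real (h $ n))"

lemma cplx_nth [simp]: "cplx h $ n = of_real (h $ n)" by (simp add: cplx_def)

lemma cplx_mult: "cplx (h * k) = cplx h * cplx k"
  by (simp add: fps_eq_iff fps_mult_nth)

lemma cplx_simps [simp]: "cplx 1 = 1" "cplx fps_X = fps_X" "cplx (fps_const c) = fps_const (of_real c)"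
  "fcnj (cplx h) = cplx h"
  by (simp_all add: fps_eq_iff fps_X_def)

lemma cplx_power: "cplx (h ^ n) = cplx h ^ n"
  by (induction n) (simp_all add: cplx_mult)

text \<open>The logarithm is obtained by integrating \<open>-\<i> \<alpha>' / \<alpha> = -\<i> \<alpha>' cnj \<alpha>\<close>, which is real
  because \<open>\<alpha>\<close> is unimodular.\<close>
lemma unimodular_exp:
  assumes a0: "\<alpha> $ 0 = 1" and uni: "\<alpha> * fcnj \<alpha> = 1"
  obtains b where "b $ 0 = 0" "\<alpha> = fps_exp 1 oo (fps_const \<i> * cplx b)"
proof -
  define \<gamma> where "\<gamma> = fcnj \<alpha>"
  have d: "fps_deriv \<alpha> * \<gamma> + \<alpha> * fps_deriv \<gamma> = 0"
    using arg_cong[OF uni, of fps_deriv] by (simp add: \<gamma>_def algebra_simps)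
  have u: "\<alpha> * \<gamma> = 1" using uni by (simp add: \<gamma>_def)
  define w where "w = fps_deriv \<alpha> * \<gamma>"
  \<comment> \<open>Differentiating \<open>\<alpha> * \<gamma> = 1\<close> shows that
    \<open>w\<close> has purely imaginary coefficients, so its integral is \<open>\<i>\<close> times
    a real series.\<close>
  have ww: "fcnj w = - w"
    using d by (simp add: w_def fcnj_mult fcnj_deriv \<gamma>_def eq_neg_iff_add_eq_0 mult.commute add.commute)
  define b where "b = Abs_fps (\<lambda>n. Im (fps_integral0 w $ n))"
  have a: "fps_const \<i> * cplx b = fps_integral0 w"
  proof (rule fps_ext)
    fix n
    show "(fps_const \<i> * cplx b) $ n = fps_integral0 w $ n"
    proof (cases n)
      case (Suc m)
      have "cnj (w $ m) = - (w $ m)" using ww by (metis fcnj_nth fps_neg_nth)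
      then have "w $ m = \<i> * of_real (Im (w $ m))" by (simp add: complex_eq_iff)
      then have "fps_integral0 w $ n = \<i> * of_real (Im (w $ m) / real (Suc m))"
        using Suc by (metis (no_types, lifting) divide_inverse fps_integral_nth_0_Suc(2) mult.assoc mult.commute
            of_real_divide of_real_of_nat_eq)
      then show ?thesis by (simp add: b_def del: of_nat_Suc)
    qed (simp add: b_def)
  qed
  \<comment> \<open>\<open>E\<close> and \<open>\<alpha>\<close> solve the same linear differential
    equation with the same initial value. As \<open>\<gamma>\<close> inverts
    \<open>\<alpha>\<close>, their equality follows once \<open>E * \<gamma>\<close> is
    constant.\<close>
  define E where "E = fps_exp 1 oo fps_integral0 w"
  have "fps_deriv E = E * w"
    by (simp add: E_def fps_compose_deriv fps_deriv_fps_integral)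
  then have "fps_deriv (E * \<gamma>) = E * (w * \<gamma> + fps_deriv \<gamma>)" by (simp add: algebra_simps)
  also have "w * \<gamma> + fps_deriv \<gamma> = \<gamma> * (fps_deriv \<alpha> * \<gamma> + \<alpha> * fps_deriv \<gamma>) + fps_deriv \<gamma> * (1 - \<alpha> * \<gamma>)"
    by (simp add: w_def algebra_simps)
  also have "\<dots> = 0" by (simp only: d u) simp
  finally have "fps_deriv (E * \<gamma>) = 0" by simp
  then have "E * \<gamma> = fps_const ((E * \<gamma>) $ 0)" by (simp only: fps_deriv_eq_0_iff)
  also have "(E * \<gamma>) $ 0 = 1" by (simp add: E_def \<gamma>_def a0)
  finally have "E * \<gamma> = 1" by simp
  then have "E * (\<alpha> * \<gamma>) = \<alpha>" by (metis mult.left_commute mult.right_neutral)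
  then have "E = \<alpha>" by (simp add: u)
  then show ?thesis using that[of b] a by (simp add: E_def b_def)
qed

text \<open>\<open>s\<close> is the order of \<open>b\<close> and \<open>eps\<close> the sign of its
  leading coefficient; the remaining factor has positive constant term and hence a real root. The
  exponent is \<open>2 * s\<close> because scaling both variables by \<open>r\<close> scales their
  product by the square of \<open>r\<close>.\<close>

lemma real_fps_root:
  fixes b :: "real fps"
  assumes "b $ 0 = 0" "b \<noteq> 0"
  obtains eps :: int and s r where "eps = 1 \<or> eps = -1" "s > 0" "r $ 0 > 0"
    "b = fps_const (of_int eps) * fps_X ^ s * r ^ (2 * s)"
proof -
  define s where "s = subdegree b"
  have s: "s > 0" using assms by (auto simp: s_def subdegree_eq_0_iff intro!: Nat.gr0I)
  define h where "h = fps_shift s b"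
  have h0: "h $ 0 \<noteq> 0" using assms(2) by (simp add: h_def s_def)
  have b: "b = h * fps_X ^ s" unfolding h_def s_def by (rule subdegree_decompose)
  define eps :: int where "eps = (if h $ 0 > 0 then 1 else -1)"
  define u where "u = fps_const (of_int eps) * h"
  have u0: "u $ 0 > 0" using h0 by (simp add: u_def eps_def)
  \<comment> \<open>\<open>Suc (2 * s - 1)\<close> is \<open>2 * s\<close> in the successor form of
    \<open>power_radical\<close>.\<close>
  define r where "r = fps_radical (\<lambda>n x. root n x) (Suc (2 * s - 1)) u"
  have "r ^ Suc (2 * s - 1) = u"
    unfolding r_def using u0 power_radical[of u "\<lambda>n x. root n x" "2 * s - 1"]
    by (simp del: power_Suc)
  then have r: "r ^ (2 * s) = u" using s by simp
  have "fps_const (of_int eps) * u = h" by (simp add: u_def eps_def flip: mult.assoc)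
  then have "b = (fps_const (of_int eps) * u) * fps_X ^ s" using b by simp
  then have "b = fps_const (of_int eps) * fps_X ^ s * r ^ (2 * s)"
    unfolding r by (simp only: mult_ac)
  moreover have "r $ 0 > 0" using u0 by (simp add: r_def)
  moreover have "eps = 1 \<or> eps = -1" by (simp add: eps_def)
  ultimately show ?thesis using that s by blast
qed

definition exp_ser :: "complex \<Rightarrow> nat \<Rightarrow> complex fps" where
  "exp_ser c n = fps_exp 1 oo (fps_const c * fps_X ^ n)"

lemma exp_ser_nth:
  assumes "n > 0"
  shows "exp_ser c n $ j = (if n dvd j then c ^ (j div n) / fact (j div n) else 0)"
proof -
  have "exp_ser c n $ j = (\<Sum>k=0..j. inverse (fact k) * (c ^ k * (if j = n * k then 1 else 0)))"
    by (simp add: exp_ser_def fps_compose_nth power_mult_distrib fps_const_power fps_X_power_nth divide_inverse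
        flip: power_mult)
  also have "\<dots> = (\<Sum>k=0..j. if k = j div n then (if n dvd j then c ^ (j div n) / fact (j div n) else 0) else 0)"
    using assms by (intro sum.cong refl) (auto simp: divide_inverse)
  also have "\<dots> = (if n dvd j then c ^ (j div n) / fact (j div n) else 0)" by simp
  finally show ?thesis .
qed

lemma fcnj_exp_ser: "fcnj (exp_ser c n) = exp_ser (cnj c) n"
proof -
  have "fcnj (fps_const c * fps_X ^ n) = fps_const (cnj c) * fps_X ^ n"
    by (simp add: fps_eq_iff fps_X_power_nth)
  then show ?thesis by (simp add: exp_ser_def fcnj_compose fcnj_exp)
qed

section \<open>Algebra of resonant maps\<close>

definition nform :: "complex \<Rightarrow> complex \<Rightarrow> complex fps \<Rightarrow> complex fps \<Rightarrow> ser_pair" where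
  "nform lam mu \<alpha> \<beta> = (Cst lam * (serX * emb \<alpha>), Cst mu * (serY * emb \<beta>))"

lemma resonant_nform:
  assumes "resonant N" "diag_linear lam mu N" "lam \<noteq> 0" "mu \<noteq> 0"
  obtains \<alpha> \<beta> where "N = nform lam mu \<alpha> \<beta>" "\<alpha> $ 0 = 1" "\<beta> $ 0 = 1"
proof -
  obtain \<alpha> \<beta> where N: "N = (serX * emb \<alpha>, serY * emb \<beta>)" using resonant_factor[OF assms(1)] .
  have C: "Cst lam * Cst (1 / lam) = 1" "Cst mu * Cst (1 / mu) = 1"
    using assms(3,4) by (simp_all flip: Cst_simps(4))
  have 0: "\<alpha> $ 0 = lam" "\<beta> $ 0 = mu"
    using assms(2) ord_geD[of 2 "fst N - Cst lam * serX" 1 0] ord_geD[of 2 "snd N - Cst mu * serY" 0 1]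
    by (simp_all add: N diag_linear_def serX_mult_nth serY_mult_nth emb_nth serX_nth serY_nth Cst_nth)
  have "N = nform lam mu (fps_const (1 / lam) * \<alpha>) (fps_const (1 / mu) * \<beta>)"
  proof -
    have "Cst lam * (serX * (Cst (1 / lam) * emb \<alpha>)) = (Cst lam * Cst (1 / lam)) * (serX * emb \<alpha>)"
      "Cst mu * (serY * (Cst (1 / mu) * emb \<beta>)) = (Cst mu * Cst (1 / mu)) * (serY * emb \<beta>)"
      by (simp_all only: mult_ac)
    then show ?thesis by (simp add: N nform_def emb_mult emb_const C)
  qed
  then show ?thesis using that[of "fps_const (1 / lam) * \<alpha>" "fps_const (1 / mu) * \<beta>"] 0 assms(3,4) by simp
qed

lemma no_const_nform: "no_const (nform lam mu \<alpha> \<beta>)"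
  by (simp add: no_const_def nform_def ord_ge_XY_mult ord_ge_Cst_mult)

lemma nform_prod:
  "fst (nform lam mu \<alpha> \<beta>) * snd (nform lam mu \<alpha> \<beta>) = emb (fps_const (lam * mu) * (fps_X * (\<alpha> * \<beta>)))"
  by (simp add: nform_def emb_mult emb_const emb_X mult_ac)

text \<open>By \<open>nform_prod\<close>, \<open>E\<close> is the action of the inner map on the
  product of the variables; the outer coefficient series are evaluated there.\<close>

lemma nform_mcomp:
  "nform a b h k \<odot> nform lam mu \<alpha> \<beta> =
    (let E = fps_const (lam * mu) * (fps_X * (\<alpha> * \<beta>)) in nform (a * lam) (b * mu) (\<alpha> * (h oo E)) (\<beta> * (k oo E)))"
proof -
  define E where "E = fps_const (lam * mu) * (fps_X * (\<alpha> * \<beta>))"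
  have z: "ord_ge (Suc 0) (fst (nform lam mu \<alpha> \<beta>))" "ord_ge (Suc 0) (snd (nform lam mu \<alpha> \<beta>))"
    using no_const_nform[of lam mu \<alpha> \<beta>] by (simp_all add: no_const_def)
  have "E $ 0 = 0" by (simp add: E_def)
  note s = subst_resonant[OF z nform_prod this[unfolded E_def]]
  show ?thesis
    unfolding Let_def mcomp_def
    by (subst (1 4) nform_def, simp only: fst_conv snd_conv s, simp add: nform_def emb_mult mult_ac)
qed

lemma nform_eq_iff:
  assumes "lam \<noteq> 0" "mu \<noteq> 0"
  shows "nform lam mu \<alpha> \<beta> = nform lam mu \<gamma> \<delta> \<longleftrightarrow> \<alpha> = \<gamma> \<and> \<beta> = \<delta>"
proof -
  have "serX \<noteq> 0" "serY \<noteq> 0" "Cst lam \<noteq> 0" "Cst mu \<noteq> 0"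
    using assms by (simp_all add: serX_def serY_def Cst_def)
  then show ?thesis by (simp add: nform_def emb_inj)
qed

lemma flip_emb: "c 0 = 0 \<Longrightarrow> flip c (emb h) = emb (Abs_fps (\<lambda>n. c (h $ n)))"
  by (rule ser_eqI) (simp add: emb_nth)

lemma flip_Cst: "cxhom c \<Longrightarrow> flip c (Cst a) = Cst (c a)"
  by (rule ser_eqI) (simp add: Cst_nth cxhomD)

lemma mflip_nform:
  "cxhom c \<Longrightarrow> mflip c (nform lam mu \<alpha> \<beta>) =
    nform (c mu) (c lam) (Abs_fps (\<lambda>n. c (\<beta> $ n))) (Abs_fps (\<lambda>n. c (\<alpha> $ n)))"
  by (simp add: mflip_def nform_def flip_Cst flip_mult flip_XY flip_emb cxhomD)

lemma id_map_nform: "id_map = nform 1 1 1 1"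
  by (simp add: id_map_def nform_def)

text \<open>Conjugation by \<open>\<tau>\<close> exchanges the linear factors and the two series.
  Multiplying the two component equations gives the equation of \<open>involution_trivial\<close>
  for \<open>\<alpha> * \<beta>\<close>.\<close>

lemma reversible_nform:
  assumes lm: "lam * mu = 1" and 0: "\<alpha> $ 0 = 1" "\<beta> $ 0 = 1"
    and rev: "nform lam mu \<alpha> \<beta> \<odot> mflip (\<lambda>x. x) (nform lam mu \<alpha> \<beta>) = id_map"
  shows "\<alpha> * \<beta> = 1"
proof -
  define E where "E = fps_X * (\<alpha> * \<beta>)"
  have ml: "mu * lam = 1" using lm by (simp add: mult.commute)
  have "mflip (\<lambda>x. x) (nform lam mu \<alpha> \<beta>) = nform mu lam \<beta> \<alpha>"
    by (simp add: mflip_nform cxhom_id fps_nth_inverse)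
  moreover have "nform lam mu \<alpha> \<beta> \<odot> nform mu lam \<beta> \<alpha> = nform 1 1 (\<beta> * (\<alpha> oo E)) (\<alpha> * (\<beta> oo E))"
    unfolding nform_mcomp Let_def lm ml E_def by (simp add: mult.commute[of \<beta> \<alpha>])
  ultimately have "nform 1 1 (\<beta> * (\<alpha> oo E)) (\<alpha> * (\<beta> oo E)) = nform 1 1 1 1"
    using rev id_map_nform by metis
  then have e: "\<beta> * (\<alpha> oo E) = 1" "\<alpha> * (\<beta> oo E) = 1" by (simp_all add: nform_eq_iff)
  have "E $ 0 = 0" by (simp add: E_def)
  then have d: "(\<alpha> * \<beta>) oo E = (\<alpha> oo E) * (\<beta> oo E)" by (rule fps_compose_mult_distrib)
  have "(\<alpha> * \<beta>) * ((\<alpha> * \<beta>) oo E) = (\<beta> * (\<alpha> oo E)) * (\<alpha> * (\<beta> oo E))"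
    unfolding d by (simp only: mult_ac)
  also have "\<dots> = 1" by (simp only: e mult_1)
  finally show ?thesis unfolding E_def by (rule involution_trivial[rotated]) (simp add: 0)
qed

text \<open>As \<open>lam * mu = 1\<close> and \<open>\<alpha> * fcnj \<alpha> = 1\<close>, the
  given map fixes the product of the variables and so leaves \<open>R\<close> unchanged, while
  \<open>nform 1 1 R R\<close> sends the product to \<open>K = fps_X * (R * R)\<close>. It remains
  to write the logarithm of \<open>\<alpha>\<close> as a constant times \<open>K ^ s\<close>, which
  \<open>real_fps_root\<close> provides.\<close>

lemma nform_rescale:
  fixes lam mu :: complex
  assumes lm: "lam * mu = 1" "cnj lam = mu"
    and \<alpha>: "\<alpha> $ 0 = 1" "\<alpha> * fcnj \<alpha> = 1" "\<alpha> \<noteq> 1"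
  obtains R eps s where "eps = 1 \<or> eps = (-1 :: int)" "s > 0" "R $ 0 \<noteq> 0" "fcnj R = R"
    "nform 1 1 R R \<odot> nform lam mu \<alpha> (fcnj \<alpha>) =
      nform lam mu (exp_ser (\<i> * of_int eps) s) (exp_ser (- (\<i> * of_int eps)) s) \<odot> nform 1 1 R R"
proof -
  obtain b where b: "b $ 0 = 0" "\<alpha> = fps_exp 1 oo (fps_const \<i> * cplx b)"
    using unimodular_exp[OF \<alpha>(1,2)] .
  have "b \<noteq> 0" using b \<alpha>(3) by (auto simp: cplx_def fps_zero_def[symmetric])
  then obtain eps :: int and s r where r: "eps = 1 \<or> eps = -1" "s > 0" "r $ 0 > 0"
    "b = fps_const (of_int eps) * fps_X ^ s * r ^ (2 * s)" using real_fps_root[OF b(1)] by blast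
  define R where "R = cplx r"
  define K where "K = fps_X * (R * R)"
  have K0: "K $ 0 = 0" by (simp add: K_def)
  have KR: "fps_const \<i> * cplx b = fps_const (\<i> * of_int eps) * K ^ s"
  proof -
    have "K ^ s = fps_X ^ s * R ^ (2 * s)"
      by (simp add: K_def power_mult_distrib power_mult power2_eq_square)
    moreover have "cplx b = fps_const (of_int eps) * fps_X ^ s * R ^ (2 * s)"
      by (simp add: r(4) cplx_mult cplx_power R_def)
    moreover have "fps_const (\<i> * of_int eps) = fps_const \<i> * fps_const (of_int eps)" by simp
    ultimately show ?thesis by (simp only: mult.assoc)
  qed
  have s0: "(fps_const (\<i> * of_int eps) * fps_X ^ s :: complex fps) $ 0 = 0"
    using r(2) by simp
  have EK: "exp_ser (\<i> * of_int eps) s oo K = \<alpha>"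
    unfolding exp_ser_def fps_compose_assoc[OF K0 s0, symmetric]
    by (simp add: fps_compose_mult_distrib[OF K0] fps_compose_power[OF K0, symmetric] K0 KR b(2))
  have RR: "fcnj R = R" by (simp add: R_def)
  have "fcnj K = K" by (simp add: K_def fcnj_mult RR) (simp add: fps_eq_iff fps_X_def)
  then have EK': "exp_ser (- (\<i> * of_int eps)) s oo K = fcnj \<alpha>"
    using arg_cong[OF EK, of fcnj] by (simp add: fcnj_compose fcnj_exp_ser)
  have "nform 1 1 R R \<odot> nform lam mu \<alpha> (fcnj \<alpha>) = nform lam mu (\<alpha> * R) (fcnj \<alpha> * R)"
    by (simp add: nform_mcomp Let_def lm \<alpha>)
  also have "\<dots> = nform lam mu (exp_ser (\<i> * of_int eps) s) (exp_ser (- (\<i> * of_int eps)) s) \<odot> nform 1 1 R R"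
    using EK EK' by (simp add: nform_mcomp Let_def K_def mult.commute)
  finally show ?thesis using that[of eps s R] r RR by (simp add: R_def)
qed

text \<open>In the real case \<open>b = cnj a\<close>, so the factor \<open>(a b)^m\<close> relating the two coefficients is positive.\<close>
lemma conjugate_resonant_coeff:
  assumes lm: "lam * mu = 1" and \<Psi>: "diag_linear a b \<Psi>"
    and N: "diag_linear lam mu N" "diag_linear lam mu N'" and ord: "ord_ge (2 * m + 1) (fst N - Cst lam * serX)"
      "ord_ge (2 * m + 1) (fst N' - Cst lam * serX)" "ord_ge (2 * m + 1) (snd N - Cst mu * serY)"
    and m: "m > 0" and conj: "\<Psi> \<odot> N = N' \<odot> \<Psi>"
  shows "a * fst N $ Suc m $ m = a ^ Suc m * b ^ m * fst N' $ Suc m $ m"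
proof -
  obtain f g where \<Psi>': "\<Psi> = (f, g)" by (cases \<Psi>)
  define L1 L2 where "L1 = Cst lam * serX" and "L2 = Cst mu * serY"
  have z: "ord_ge (Suc 0) (fst N)" "ord_ge (Suc 0) (snd N)" "ord_ge (Suc 0) L1" "ord_ge (Suc 0) L2"
    "ord_ge (Suc 0) f" "ord_ge (Suc 0) g"
    using diag_linear_no_const[OF N(1)] diag_linear_no_const[OF \<Psi>] by (auto simp: no_const_def L1_def L2_def \<Psi>' ord_ge_linear)
  have fg: "ord_ge 2 (f - Cst a * serX)" "ord_ge 2 (g - Cst b * serY)" using \<Psi> by (auto simp: diag_linear_def \<Psi>')
  have f: "ord_ge 2 (f - (Cst a * serX + Cst 0 * serY))" using fg by simp
  \<comment> \<open>By resonance the coefficient of \<open>f\<close> at this position enters both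
    sides with the same factor \<open>lam\<close> and cancels at the end.\<close>
  have pw: "lam ^ Suc m * mu ^ m = lam"
    using arg_cong[OF lm, of "\<lambda>x. lam * x ^ m"] by (simp add: power_mult_distrib mult.assoc)
  \<comment> \<open>The position has degree \<open>2 * m + 1\<close>, where the deviation of
    \<open>N\<close> from its linear part begins, so this deviation is seen only by the linear part
    of \<open>f\<close>.\<close>
  have "subst f (fst N) (snd N) $ Suc m $ m - subst f L1 L2 $ Suc m $ m
      = a * (fst N - L1) $ Suc m $ m + 0 * (snd N - L2) $ Suc m $ m"
    using ord by (intro subst_perturb[OF f z(3,1) _ z(4,2), where n = "2 * m + 1"]) (auto simp: L1_def L2_def)
  moreover have "subst f L1 L2 $ Suc m $ m = lam * f $ Suc m $ m"
    unfolding L1_def L2_def subst_linear_nth pw ..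
  moreover have "L1 $ Suc m $ m = 0" using m by (simp add: L1_def serX_nth)
  moreover have "subst (fst N' - L1) f g $ Suc m $ m = a ^ Suc m * b ^ m * (fst N' - L1) $ Suc m $ m"
    using ord by (intro subst_leading[OF _ fg]) (auto simp: L1_def)
  moreover have "subst L1 f g = Cst lam * f" using z by (simp add: L1_def subst_Cst_mult)
  moreover have "subst f (fst N) (snd N) = subst (fst N') f g" using conj by (simp add: mcomp_def \<Psi>')
  ultimately show ?thesis by (simp add: subst_diff)
qed

section \<open>Normal form and invariants\<close>

definition mser :: "fmap2 \<Rightarrow> ser_pair" where
  "mser \<Phi> = (ser (fst \<Phi>), ser (snd \<Phi>))"

lemma ser_inj: "ser F = ser G \<longleftrightarrow> F = G"
  by (auto simp: ser_eq_iff)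

lemma mser_inj: "mser \<Phi> = mser \<Psi> \<longleftrightarrow> \<Phi> = \<Psi>"
  by (auto simp: mser_def ser_inj prod_eq_iff)

lemma mser_surj: obtains \<Phi>' where "mser \<Phi>' = \<Phi>"
proof
  show "mser (\<lambda>i j. fst \<Phi> $ i $ j, \<lambda>i j. snd \<Phi> $ i $ j) = \<Phi>"
    by (auto simp: mser_def intro!: prod_eqI ser_eqI)
qed

lemma ser_mult: "ser (fps2_mult a b) = ser a * ser b"
  by (rule ser_eqI) (simp add: fps2_mult_def ser_mult_nth)

lemma ser_pow: "ser (fps2_pow a n) = ser a ^ n"
proof (induction n)
  case 0
  show ?case by (rule ser_eqI) (simp add: fps2_pow_def fps2_one_def)
next
  case (Suc n)
  have "fps2_pow a (Suc n) = fps2_mult a (fps2_pow a n)" by (simp add: fps2_pow_def)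
  then show ?case using Suc by (simp add: ser_mult)
qed

lemma ser_comp: "ser (fps2_comp F f g) = subst (ser F) (ser f) (ser g)"
proof -
  have "fps2_mult (fps2_pow f k) (fps2_pow g l) i j = (ser f ^ k * ser g ^ l) $ i $ j" for k l i j
    by (metis ser_mult ser_nth ser_pow)
  then show ?thesis by (intro ser_eqI) (simp add: fps2_comp_def subst_nth)
qed

lemma mser_comp: "mser (\<Phi> \<circ>\<^sub>f \<Psi>) = mser \<Phi> \<odot> mser \<Psi>"
  by (simp add: mser_def fmap_comp_def mcomp_def ser_comp)

lemma ser_X: "ser fps2_X = serX" and ser_Y: "ser fps2_Y = serY"
  by (auto intro!: ser_eqI simp: fps2_X_def fps2_Y_def serX_nth serY_nth)

lemma mser_id: "mser fmap_id = id_map"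
  by (simp add: mser_def fmap_id_def id_map_def ser_X ser_Y)

lemma real_fmap_iff: "real_fmap \<Phi> \<longleftrightarrow> mflip cnj (mser \<Phi>) = mser \<Phi>"
proof -
  have "mser (rho_conj \<Phi>) = mflip cnj (mser \<Phi>)"
    by (auto simp: mser_def rho_conj_def mflip_def intro!: ser_eqI)
  then show ?thesis by (metis mser_inj real_fmap_def)
qed

lemma subst_swap: "subst F serY serX = flip (\<lambda>x. x) F"
proof (rule ser_eqI)
  fix i j
  have "subst F serY serX $ i $ j = (\<Sum>k\<le>i+j. \<Sum>l\<le>i+j. F $ k $ l * (serX ^ l * serY ^ k) $ i $ j)"
    by (subst subst_nth_box[of _ _ i j "i + j"]) (simp_all add: mult.commute)
  also have "\<dots> = (\<Sum>k\<le>i+j. \<Sum>l\<le>i+j. if l = i then (if k = j then F $ j $ i else 0) else 0)"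
    by (intro sum.cong refl) (auto simp: monom_nth)
  also have "\<dots> = F $ j $ i" by simp
  finally show "subst F serY serX $ i $ j = flip (\<lambda>x. x) F $ i $ j" by simp
qed

lemma mser_tau: "mser tau_map = (serY, serX)"
  by (simp add: mser_def tau_map_def ser_X ser_Y)

lemma tau_left: "no_const \<Phi> \<Longrightarrow> (serY, serX) \<odot> \<Phi> = (snd \<Phi>, fst \<Phi>)"
  and tau_right: "\<Phi> \<odot> (serY, serX) = (flip (\<lambda>x. x) (fst \<Phi>), flip (\<lambda>x. x) (snd \<Phi>))"
  by (simp_all add: mcomp_def no_const_def subst_swap)

lemma mser_tau_conj: "no_const (mser \<Phi>) \<Longrightarrow> mser (tau_map \<circ>\<^sub>f \<Phi> \<circ>\<^sub>f tau_map) = mflip (\<lambda>x. x) (mser \<Phi>)"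
  by (simp add: mser_comp mser_tau tau_left tau_right mflip_def)

lemma tau_commute_iff:
  "no_const (mser \<Phi>) \<Longrightarrow> tau_map \<circ>\<^sub>f \<Phi> = \<Phi> \<circ>\<^sub>f tau_map \<longleftrightarrow> mflip (\<lambda>x. x) (mser \<Phi>) = mser \<Phi>"
  by (subst mser_inj[symmetric]) (auto simp: mser_comp mser_tau tau_left tau_right mflip_def prod_eq_iff)

lemma diag_linear_coeffs:
  assumes "diag_linear a b \<Phi>"
  shows "fst \<Phi> $ 0 $ 0 = 0" "fst \<Phi> $ 1 $ 0 = a" "fst \<Phi> $ 0 $ 1 = 0"
    "snd \<Phi> $ 0 $ 0 = 0" "snd \<Phi> $ 1 $ 0 = 0" "snd \<Phi> $ 0 $ 1 = b"
proof -
  have o: "ord_ge 2 (fst \<Phi> - Cst a * serX)" "ord_ge 2 (snd \<Phi> - Cst b * serY)" using assms by (auto simp: diag_linear_def)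
  show "fst \<Phi> $ 0 $ 0 = 0" "fst \<Phi> $ 1 $ 0 = a" "fst \<Phi> $ 0 $ 1 = 0"
    using ord_geD[OF o(1), of 0 0] ord_geD[OF o(1), of 1 0] ord_geD[OF o(1), of 0 1] by (simp_all add: serX_nth Cst_nth)
  show "snd \<Phi> $ 0 $ 0 = 0" "snd \<Phi> $ 1 $ 0 = 0" "snd \<Phi> $ 0 $ 1 = b"
    using ord_geD[OF o(2), of 0 0] ord_geD[OF o(2), of 1 0] ord_geD[OF o(2), of 0 1] by (simp_all add: serY_nth Cst_nth)
qed

lemma formal_transformation_diag_linear:
  "diag_linear a b (mser \<Phi>) \<Longrightarrow> a \<noteq> 0 \<Longrightarrow> b \<noteq> 0 \<Longrightarrow> formal_transformation \<Phi>"
  using diag_linear_coeffs[of a b "mser \<Phi>"] by (simp add: formal_transformation_def mser_def)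

lemma ord_ge_2_iff: "ord_ge 2 F \<longleftrightarrow> F $ 0 $ 0 = 0 \<and> F $ 1 $ 0 = 0 \<and> F $ 0 $ 1 = 0"
proof -
  have "i + j < 2 \<longleftrightarrow> (i = 0 \<and> j = 0) \<or> (i = 1 \<and> j = 0) \<or> (i = 0 \<and> j = 1)" for i j :: nat by auto
  then show ?thesis unfolding ord_ge_def by metis
qed

lemma admissible_mser:
  assumes "admissible lam p q"
  defines "\<phi> \<equiv> mser (phi_map lam p q)"
  shows "diag_linear lam (cnj lam) \<phi>" "lam * cnj lam = 1" "mflip cnj \<phi> = \<phi>" "mflip (\<lambda>x. x) \<phi> \<odot> \<phi> = id_map"
proof -
  have "ser (\<lambda>i j. lam * fps2_X i j + p i j) - Cst lam * serX = ser p"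
    "ser (\<lambda>i j. cnj lam * fps2_Y i j + q i j) - Cst (cnj lam) * serY = ser q"
    by (auto intro!: ser_eqI simp: ser_X[symmetric] ser_Y[symmetric])
  moreover have "ord_ge 2 (ser p)" "ord_ge 2 (ser q)"
    using assms(1) by (auto simp: admissible_def fps2_order_ge2_def ord_ge_2_iff)
  ultimately show d: "diag_linear lam (cnj lam) \<phi>" by (simp add: diag_linear_def \<phi>_def mser_def phi_map_def)
  have "(tau_map \<circ>\<^sub>f phi_map lam p q \<circ>\<^sub>f tau_map) \<circ>\<^sub>f phi_map lam p q = fmap_id"
    using assms(1) by (simp add: admissible_def)
  then have "mser (tau_map \<circ>\<^sub>f phi_map lam p q \<circ>\<^sub>f tau_map) \<odot> \<phi> = id_map"
    by (metis mser_comp mser_id \<phi>_def)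
  then show r: "mflip (\<lambda>x. x) \<phi> \<odot> \<phi> = id_map" using mser_tau_conj diag_linear_no_const[OF d] by (simp add: \<phi>_def)
  \<comment> \<open>\<open>\<tau>\<close> exchanges \<open>lam\<close> and \<open>cnj lam\<close>,
    so the linear coefficient of the reversibility relation is their product, and the identity has 1
    there.\<close>
  show "lam * cnj lam = 1"
    using diag_linear_coeffs(2)[OF diag_linear_mcomp[OF diag_linear_mflip[OF cxhom_id d] d]]
    unfolding r by (simp add: id_map_def serX_nth mult.commute)
  show "mflip cnj \<phi> = \<phi>" using assms(1) by (simp add: admissible_def real_fmap_iff \<phi>_def)
qed

section \<open>The normal form as a resonant map\<close>

definition normal_series :: "int \<Rightarrow> enat \<Rightarrow> complex fps" where
  "normal_series eps s = (if s = \<infinity> then 1 else exp_ser (\<i> * of_int eps) (the_enat s))"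

text \<open>These values let the invariants be read off: \<open>s\<close> as the position and
  \<open>eps\<close> from the value of the first nonconstant coefficient.\<close>

lemma normal_series_nth:
  assumes "valid_invariants eps s"
  shows "normal_series eps s $ 0 = 1" "m > 0 \<Longrightarrow> enat m < s \<Longrightarrow> normal_series eps s $ m = 0"
    "s = enat m \<Longrightarrow> normal_series eps s $ m = \<i> * of_int eps"
proof -
  show "normal_series eps s $ 0 = 1" by (simp add: normal_series_def exp_ser_def)
  show "m > 0 \<Longrightarrow> enat m < s \<Longrightarrow> normal_series eps s $ m = 0"
    by (cases s) (auto simp: normal_series_def exp_ser_nth dest: dvd_imp_le)
  show "s = enat m \<Longrightarrow> normal_series eps s $ m = \<i> * of_int eps"
    using assms by (auto simp: normal_series_def exp_ser_nth valid_invariants_def zero_enat_def)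
qed

lemma mser_normal_form:
  assumes "valid_invariants eps s"
  shows "mser (normal_form lam eps s) = nform lam (cnj lam) (normal_series eps s) (fcnj (normal_series eps s))"
proof (cases s)
  case (enat n)
  then have "n > 0" using assms by (auto simp: valid_invariants_def zero_enat_def)
  then show ?thesis using enat
    by (auto simp: mser_def normal_form_def nform_def normal_series_def Let_def fcnj_exp_ser exp_ser_nth emb_nth
        serX_mult_nth serY_mult_nth gr0_conv_Suc intro!: ser_eqI)
next
  case infinity
  then show ?thesis
    by (auto simp: mser_def normal_form_def nform_def normal_series_def ser_X[symmetric] ser_Y[symmetric] intro!: ser_eqI)
qed

text \<open>The coefficient of index \<open>j\<close> in \<open>\<alpha>\<close> or
  \<open>\<beta>\<close> sits in total degree \<open>2 * j + 1\<close> of the map.\<close>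

lemma nform_order:
  assumes "\<alpha> $ 0 = 1" "\<beta> $ 0 = 1" "\<And>j. 0 < j \<Longrightarrow> j < m \<Longrightarrow> \<alpha> $ j = 0 \<and> \<beta> $ j = 0"
  shows "ord_ge (2 * m + 1) (fst (nform lam mu \<alpha> \<beta>) - Cst lam * serX)"
    "ord_ge (2 * m + 1) (snd (nform lam mu \<alpha> \<beta>) - Cst mu * serY)"
  using assms unfolding ord_ge_def nform_def
  by (auto simp: serX_mult_nth serY_mult_nth emb_nth serX_nth serY_nth gr0_conv_Suc)

lemma diag_linear_nform: assumes "\<alpha> $ 0 = 1" "\<beta> $ 0 = 1" shows "diag_linear lam mu (nform lam mu \<alpha> \<beta>)"
  using nform_order[of \<alpha> \<beta> 1 lam mu] assms by (auto simp: diag_linear_def intro: ord_ge_mono)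

lemma diag_linear_normal_form:
  "valid_invariants eps s \<Longrightarrow> diag_linear lam (cnj lam) (mser (normal_form lam eps s))"
  by (simp add: mser_normal_form diag_linear_nform normal_series_nth)

section \<open>Real conjugacies and their inverses\<close>

text \<open>Reality gives the linear part the rows \<open>A\<close>, \<open>B\<close> and
  \<open>cnj B\<close>, \<open>cnj A\<close>. Linear terms of the conjugacy yield
  \<open>A * lam = lam' * A\<close> and \<open>B * cnj lam = lam' * B\<close>; the signs of the
  imaginary parts force \<open>B = 0\<close>, and invertibility then makes \<open>A\<close>
  nonzero.\<close>

lemma real_conjugacy_linear:
  assumes ft: "formal_transformation \<Psi>" and re: "real_fmap \<Psi>"
    and d: "diag_linear lam (cnj lam) \<phi>" "diag_linear lam' (cnj lam') \<phi>'" and pos: "Im lam > 0" "Im lam' > 0"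
    and conj: "mser \<Psi> \<odot> \<phi> = \<phi>' \<odot> mser \<Psi>"
  shows "lam = lam' \<and> (\<exists>a. a \<noteq> 0 \<and> diag_linear a (cnj a) (mser \<Psi>))"
proof -
  define f g A B where "f = fst (mser \<Psi>)" and "g = snd (mser \<Psi>)" and "A = f $ 1 $ 0" and "B = f $ 0 $ 1"
  have g: "g $ i $ j = cnj (f $ j $ i)" for i j
    using re unfolding real_fmap_iff f_def g_def by (metis flip_nth mflip_def snd_conv fst_conv)
  have f0: "f $ 0 $ 0 = 0" using ft by (simp add: formal_transformation_def f_def mser_def)
  have det: "A * cnj A - B * cnj B \<noteq> 0"
    using ft g[of 0 1] g[of 1 0] by (simp add: formal_transformation_def f_def g_def mser_def A_def B_def)
  have z: "ord_ge (Suc 0) f" "ord_ge (Suc 0) g" using f0 g[of 0 0] by (simp_all add: ord_ge_def)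
  have z': "ord_ge (Suc 0) (fst \<phi>)" "ord_ge (Suc 0) (snd \<phi>)" using diag_linear_no_const[OF d(1)] by (auto simp: no_const_def)
  have "ord_ge 2 (f - (Cst A * serX + Cst B * serY))"
    by (simp add: ord_ge_2_iff f0 A_def B_def serX_nth serY_nth Cst_nth)
  from subst_linear_part[OF this z'] have 1: "ord_ge 2 (subst f (fst \<phi>) (snd \<phi>) - (Cst A * fst \<phi> + Cst B * snd \<phi>))" .
  have "ord_ge 2 (fst \<phi>' - (Cst lam' * serX + Cst 0 * serY))" using d(2) by (simp add: diag_linear_def)
  from subst_linear_part[OF this z] have 2: "ord_ge 2 (subst (fst \<phi>') f g - Cst lam' * f)" by simp
  have eq: "subst f (fst \<phi>) (snd \<phi>) = subst (fst \<phi>') f g"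
    using conj by (simp add: mcomp_def f_def g_def)
  have e1: "A * lam = lam' * A" and e2: "B * cnj lam = lam' * B"
    using 1 2 diag_linear_coeffs[OF d(1)] unfolding ord_ge_2_iff eq
    by (auto simp: A_def B_def simp del: fps_mult_nth_0 fps_mult_nth_1 fps_mult_nth_1')
  have "cnj lam \<noteq> lam'" using pos by (auto simp: complex_eq_iff)
  then have B: "B = 0" using e2 by (auto simp: mult.commute)
  then have A: "A \<noteq> 0" using det by auto
  have "diag_linear A (cnj A) (mser \<Psi>)"
    using f0 B g[of 0 0] g[of 0 1] g[of 1 0]
    by (simp add: diag_linear_def ord_ge_2_iff serX_nth serY_nth Cst_nth f_def[symmetric] g_def[symmetric] A_def B_def)
  then show ?thesis using A e1 by (auto simp: mult.commute)
qed

lemma has_normal_formE: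
  assumes nf: "has_normal_form (phi_map lam p q) lam eps s" and val: "valid_invariants eps s"
    and adm: "admissible lam p q"
  obtains \<Phi> a where "a \<noteq> 0" "diag_linear a (cnj a) \<Phi>" "mflip cnj \<Phi> = \<Phi>"
    "\<Phi> \<odot> mser (phi_map lam p q) = mser (normal_form lam eps s) \<odot> \<Phi>"
proof -
  obtain \<Phi> where \<Phi>: "formal_transformation \<Phi>" "real_fmap \<Phi>"
    "\<Phi> \<circ>\<^sub>f phi_map lam p q = normal_form lam eps s \<circ>\<^sub>f \<Phi>" using nf by (auto simp: has_normal_form_def)
  have c: "mser \<Phi> \<odot> mser (phi_map lam p q) = mser (normal_form lam eps s) \<odot> mser \<Phi>"
    by (metis \<Phi>(3) mser_comp)
  have "Im lam > 0" using adm by (simp add: admissible_def)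
  with real_conjugacy_linear[OF \<Phi>(1,2) admissible_mser(1)[OF adm] diag_linear_normal_form[OF val] _ _ c]
  show ?thesis using that c \<Phi>(2) unfolding real_fmap_iff by blast
qed

text \<open>Conjugating an inverse of \<open>\<Phi>\<close> gives an inverse of
  \<open>\<Phi>\<close> again, so reality follows from uniqueness of inverses.\<close>

lemma real_inverse:
  assumes "a \<noteq> 0" "diag_linear a (cnj a) \<Phi>" "mflip cnj \<Phi> = \<Phi>"
  obtains \<Psi> where "diag_linear (1 / a) (cnj (1 / a)) \<Psi>" "mflip cnj \<Psi> = \<Psi>" "\<Phi> \<odot> \<Psi> = id_map" "\<Psi> \<odot> \<Phi> = id_map"
proof -
  obtain \<Psi> where \<Psi>: "diag_linear (1 / a) (1 / cnj a) \<Psi>" "\<Phi> \<odot> \<Psi> = id_map" "\<Psi> \<odot> \<Phi> = id_map"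
    using inverse_exists[OF assms(2)] assms(1) by auto
  have z: "no_const \<Phi>" "no_const \<Psi>" "no_const (mflip cnj \<Psi>)"
    using diag_linear_no_const[OF assms(2)] diag_linear_no_const[OF \<Psi>(1)] diag_linear_no_const[OF diag_linear_mflip[OF cxhom_cnj \<Psi>(1)]] by auto
  have "mflip cnj \<Phi> \<odot> mflip cnj \<Psi> = id_map"
    using mflip_mcomp[OF cxhom_cnj z(2), of \<Phi>] \<Psi>(2) by (simp add: mflip_id_map cxhom_cnj)
  then have "\<Phi> \<odot> mflip cnj \<Psi> = id_map" by (simp add: assms(3))
  then have "\<Psi> = (\<Psi> \<odot> \<Phi>) \<odot> mflip cnj \<Psi>" using z by (simp add: mcomp_assoc mcomp_id_map)
  then have "mflip cnj \<Psi> = \<Psi>" using z by (simp add: \<Psi>(3) id_map_mcomp)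
  then show ?thesis using that \<Psi> by simp
qed

lemma conjugacy_trans:
  assumes "\<Phi> \<odot> \<phi> = \<phi>' \<odot> \<Phi>" "\<Psi> \<odot> \<phi>' = \<phi>'' \<odot> \<Psi>" "no_const \<Phi>" "no_const \<phi>" "no_const \<phi>'" "no_const \<Psi>"
  shows "(\<Psi> \<odot> \<Phi>) \<odot> \<phi> = \<phi>'' \<odot> (\<Psi> \<odot> \<Phi>)"
proof -
  have "(\<Psi> \<odot> \<Phi>) \<odot> \<phi> = \<Psi> \<odot> (\<phi>' \<odot> \<Phi>)" using assms by (simp add: mcomp_assoc)
  also have "\<dots> = (\<phi>'' \<odot> \<Psi>) \<odot> \<Phi>" using assms by (simp add: mcomp_assoc[symmetric])
  finally show ?thesis using assms by (simp add: mcomp_assoc)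
qed

lemma conjugacy_inverse:
  assumes "\<Phi> \<odot> \<phi> = \<phi>' \<odot> \<Phi>" "\<Phi> \<odot> \<Psi> = id_map" "\<Psi> \<odot> \<Phi> = id_map" "no_const \<Phi>" "no_const \<Psi>" "no_const \<phi>" "no_const \<phi>'"
  shows "\<Psi> \<odot> \<phi>' = \<phi> \<odot> \<Psi>"
proof -
  have "\<Psi> \<odot> \<phi>' = (\<Psi> \<odot> \<phi>') \<odot> (\<Phi> \<odot> \<Psi>)"
    by (simp add: assms(2) mcomp_id_map)
  also have "\<dots> = \<Psi> \<odot> (\<phi>' \<odot> \<Phi>) \<odot> \<Psi>" using assms(4-7) by (simp add: mcomp_assoc no_const_mcomp)
  also have "\<dots> = \<Psi> \<odot> (\<Phi> \<odot> \<phi>) \<odot> \<Psi>" by (simp add: assms(1))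
  also have "\<dots> = (\<Psi> \<odot> \<Phi>) \<odot> (\<phi> \<odot> \<Psi>)" using assms(4-7) by (simp add: mcomp_assoc no_const_mcomp)
  also have "\<dots> = \<phi> \<odot> \<Psi>" using assms(3,6) by (simp add: id_map_mcomp no_const_mcomp)
  finally show ?thesis .
qed

section \<open>Existence of the normal form\<close>

lemma normal_form_exists:
  assumes adm: "admissible lam p q" and nr: "\<forall>n>0. lam ^ n \<noteq> 1"
  shows "\<exists>eps s. valid_invariants eps s \<and> has_normal_form (phi_map lam p q) lam eps s"
proof -
  define \<phi> where "\<phi> = mser (phi_map lam p q)"
  note a = admissible_mser[OF adm, folded \<phi>_def]
  have lm0: "lam \<noteq> 0" "cnj lam \<noteq> 0" using a(2) by auto
  obtain \<Phi> N where \<Phi>: "normalized \<Phi>" "resonant N" "diag_linear lam (cnj lam) N" "\<Phi> \<odot> \<phi> = N \<odot> \<Phi>"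
    using resonant_conjugation_exists[OF a(2) nr a(1)] by blast
  have re: "mflip cnj \<Phi> = \<Phi>" "mflip cnj N = N"
    using normalized_conjugation_real[OF a(2) nr refl a(1,3) \<Phi>] by auto
  have rv: "mflip (\<lambda>x. x) \<Phi> = \<Phi>" "N \<odot> mflip (\<lambda>x. x) N = id_map"
    using normalized_conjugation_reversible[OF a(2) nr a(1,4) \<Phi>] by auto
  obtain \<alpha> \<beta> where N: "N = nform lam (cnj lam) \<alpha> \<beta>" and 0: "\<alpha> $ 0 = 1" "\<beta> $ 0 = 1"
    using resonant_nform[OF \<Phi>(2,3) lm0] .
  have "\<beta> = fcnj \<alpha>"
    using re(2) lm0 by (simp add: N mflip_nform cxhom_cnj nform_eq_iff fcnj_def)
  with reversible_nform[OF a(2) 0] rv(2) have uni: "\<alpha> * fcnj \<alpha> = 1" by (simp add: N)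
  have N': "N = nform lam (cnj lam) \<alpha> (fcnj \<alpha>)" by (simp add: N \<open>\<beta> = fcnj \<alpha>\<close>)
  have d: "diag_linear 1 1 \<Phi>" using \<Phi>(1) by (simp add: normalized_def)
  \<comment> \<open>Common ending of both cases: an \<open>\<Omega>\<close> with scalar linear part,
    both symmetries and the conjugacy equation is carried back to coefficient functions.\<close>
  have finish: ?thesis
    if val: "valid_invariants eps s" and "c \<noteq> 0" "diag_linear c c \<Omega>" "mflip cnj \<Omega> = \<Omega>" "mflip (\<lambda>x. x) \<Omega> = \<Omega>"
      and c: "\<Omega> \<odot> \<phi> = mser (normal_form lam eps s) \<odot> \<Omega>" for eps s c \<Omega>
  proof -
    obtain \<Omega>' where \<Omega>': "mser \<Omega>' = \<Omega>" by (rule mser_surj)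
    have "formal_transformation \<Omega>'" using formal_transformation_diag_linear that \<Omega>' by blast
    moreover have "real_fmap \<Omega>'" "tau_map \<circ>\<^sub>f \<Omega>' = \<Omega>' \<circ>\<^sub>f tau_map"
      using that diag_linear_no_const[of c c \<Omega>] by (simp_all add: real_fmap_iff tau_commute_iff \<Omega>')
    moreover have "\<Omega>' \<circ>\<^sub>f phi_map lam p q = normal_form lam eps s \<circ>\<^sub>f \<Omega>'"
      using c by (simp add: \<phi>_def mser_comp \<Omega>' flip: mser_inj)
    ultimately show ?thesis using val unfolding has_normal_form_def by blast
  qed
  show ?thesis
  proof (cases "\<alpha> = 1")
    case True
    have val: "valid_invariants 0 \<infinity>" by (simp add: valid_invariants_def)
    have "N = mser (normal_form lam 0 \<infinity>)" by (simp add: N' True mser_normal_form[OF val] normal_series_def)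
    then show ?thesis using finish[OF val _ d re(1) rv(1)] \<Phi>(4) by simp
  next
    case False
    obtain R eps s where R: "eps = 1 \<or> eps = (-1 :: int)" "s > 0" "R $ 0 \<noteq> 0" "fcnj R = R"
      and c: "nform 1 1 R R \<odot> N =
       nform lam (cnj lam) (exp_ser (\<i> * of_int eps) s) (exp_ser (- (\<i> * of_int eps)) s) \<odot> nform 1 1 R R"
      using nform_rescale[OF a(2) refl 0(1) uni False] unfolding N' by metis
    have val: "valid_invariants eps (enat s)" using R by (simp add: valid_invariants_def zero_enat_def)
    define S where "S = nform 1 1 R R"
    have S: "diag_linear (R $ 0) (R $ 0) S"
      by (simp add: S_def nform_def diag_linear_def ord_ge_2_iff serX_mult_nth serY_mult_nth emb_nth serX_nth serY_nth Cst_nth)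
    have "mser (normal_form lam eps (enat s)) =
        nform lam (cnj lam) (exp_ser (\<i> * of_int eps) s) (exp_ser (- (\<i> * of_int eps)) s)"
      by (simp add: mser_normal_form[OF val] normal_series_def fcnj_exp_ser)
    then have c': "S \<odot> N = mser (normal_form lam eps (enat s)) \<odot> S" using c by (simp add: S_def)
    \<comment> \<open>Both components of \<open>S\<close> carry the same \<open>R\<close>, whence
      the symmetry under \<open>\<tau>\<close>; its coefficients are real, whence the symmetry under
      \<open>\<rho>\<close>.\<close>
    have Ss: "mflip cnj S = S" "mflip (\<lambda>x. x) S = S"
      using R(4) by (simp_all add: S_def mflip_nform cxhom_cnj cxhom_id fcnj_def fps_nth_inverse)
    note z = diag_linear_no_const[OF d] diag_linear_no_const[OF S] diag_linear_no_const[OF a(1)] diag_linear_no_const[OF \<Phi>(3)]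
    show ?thesis
    proof (rule finish[OF val R(3)])
      show "diag_linear (R $ 0) (R $ 0) (S \<odot> \<Phi>)" using diag_linear_mcomp[OF S d] by simp
      show "mflip cnj (S \<odot> \<Phi>) = S \<odot> \<Phi>" "mflip (\<lambda>x. x) (S \<odot> \<Phi>) = S \<odot> \<Phi>"
        using z by (simp_all add: mflip_mcomp cxhom_cnj cxhom_id Ss re rv)
      show "(S \<odot> \<Phi>) \<odot> \<phi> = mser (normal_form lam eps (enat s)) \<odot> (S \<odot> \<Phi>)"
        using conjugacy_trans[OF \<Phi>(4) c'] z by simp
    qed
  qed
qed

section \<open>Invariance and completeness of the triple\<close>

text \<open>Conjugation scales the first resonant coefficient by the positive number
  \<open>(norm a)\<^sup>2 ^ m\<close>, which can neither annihilate it nor change its sign.\<close>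

lemma normal_form_invariants:
  assumes lm: "lam * cnj lam = 1" and v: "valid_invariants eps s" "valid_invariants eps' s'"
    and \<Psi>: "a \<noteq> 0" "diag_linear a (cnj a) \<Psi>"
    and conj: "\<Psi> \<odot> mser (normal_form lam eps s) = mser (normal_form lam eps' s') \<odot> \<Psi>"
  shows "eps = eps' \<and> s = s'"
proof -
  have lam0: "lam \<noteq> 0" using lm by auto
  have key: "normal_series eps s $ m = of_real ((norm a)\<^sup>2 ^ m) * normal_series eps' s' $ m"
    if m: "m > 0" "enat m \<le> s" "enat m \<le> s'" for m
  proof -
    have z: "normal_series eps s $ j = 0" "normal_series eps' s' $ j = 0" if "0 < j" "j < m" for j
    proof -
      have "enat j < enat m" using that by simp
      then show "normal_series eps s $ j = 0" "normal_series eps' s' $ j = 0"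
        using m that normal_series_nth(2)[OF v(1), of j] normal_series_nth(2)[OF v(2), of j] by (metis less_le_trans)+
    qed
    have o: "ord_ge (2 * m + 1) (fst (mser (normal_form lam eps s)) - Cst lam * serX)"
      "ord_ge (2 * m + 1) (fst (mser (normal_form lam eps' s')) - Cst lam * serX)"
      "ord_ge (2 * m + 1) (snd (mser (normal_form lam eps s)) - Cst (cnj lam) * serY)"
      unfolding mser_normal_form[OF v(1)] mser_normal_form[OF v(2)]
      by (rule nform_order; simp add: normal_series_nth[OF v(1)] normal_series_nth[OF v(2)] z)+
    have "a * fst (mser (normal_form lam eps s)) $ Suc m $ m
        = a ^ Suc m * cnj a ^ m * fst (mser (normal_form lam eps' s')) $ Suc m $ m"
      by (rule conjugate_resonant_coeff[OF lm \<Psi>(2) diag_linear_normal_form[OF v(1)] diag_linear_normal_form[OF v(2)] o m(1) conj])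
    then have "a * (lam * normal_series eps s $ m) = a * (a * cnj a) ^ m * (lam * normal_series eps' s' $ m)"
      by (simp add: mser_normal_form v nform_def serX_mult_nth emb_nth power_mult_distrib)
    moreover have "of_real ((norm a)\<^sup>2 ^ m) = (a * cnj a) ^ m" by (metis complex_norm_square of_real_power)
    ultimately show ?thesis using \<Psi>(1) lam0 by (simp del: of_real_power)
  qed
  have pos: "(norm a)\<^sup>2 > 0" using \<Psi>(1) by simp
  \<comment> \<open>The coefficient at the smaller exponent decides: it is nonzero on one side,
    hence on the other. So a strict inequality is contradictory, and for equal exponents the
    imaginary parts give the sign.\<close>
  consider m where "s = enat m" "s \<le> s'" | m where "s' = enat m" "s' < s" | "s = \<infinity>" "s' = \<infinity>"
  proof (cases s; cases s')
    fix m n assume "s = enat m" "s' = enat n"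
    then show thesis using that(1,2) by (cases "m \<le> n") auto
  qed (use that in auto)
  then show ?thesis
  proof cases
    case 1
    have m: "m > 0" and e: "eps = 1 \<or> eps = -1" using v(1) 1 by (auto simp: valid_invariants_def zero_enat_def)
    have k: "\<i> * of_int eps = of_real ((norm a)\<^sup>2 ^ m) * normal_series eps' s' $ m"
      using key[of m] m 1 normal_series_nth(3)[OF v(1) 1(1)] by simp
    have s: "s' = enat m"
    proof (rule ccontr)
      assume "s' \<noteq> enat m"
      then have "normal_series eps' s' $ m = 0" using normal_series_nth(2)[OF v(2) m] 1 by auto
      then show False using k e by auto
    qed
    have "\<i> * of_int eps = of_real ((norm a)\<^sup>2 ^ m) * (\<i> * of_int eps')"
      using k normal_series_nth(3)[OF v(2) s] by simp
    then have "Im (\<i> * of_int eps) = Im (of_real ((norm a)\<^sup>2 ^ m) * (\<i> * of_int eps'))" by simp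
    then have "real_of_int eps = (norm a)\<^sup>2 ^ m * real_of_int eps'" by simp
    moreover have "(norm a)\<^sup>2 ^ m > 0" using pos by simp
    moreover have "eps' = 1 \<or> eps' = -1" using v(2) s by (auto simp: valid_invariants_def)
    ultimately have "eps = eps'" using e by auto
    then show ?thesis using s 1 by simp
  next
    case 2
    have m: "m > 0" and e: "eps' = 1 \<or> eps' = -1" using v(2) 2 by (auto simp: valid_invariants_def zero_enat_def)
    have "normal_series eps s $ m = 0" using normal_series_nth(2)[OF v(1) m] 2 by simp
    with key[of m] m 2 normal_series_nth(3)[OF v(2) 2(1)] pos e show ?thesis by auto
  next
    case 3
    then show ?thesis using v by (simp add: valid_invariants_def)
  qed
qed

theorem theorem2p1:
  fixes lam :: complex and p q :: fps2
  assumes adm: "admissible lam p q"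
    and not_root: "\<forall>n::nat. n > 0 \<longrightarrow> lam ^ n \<noteq> 1"
  shows "(\<exists>eps s. valid_invariants eps s \<and> has_normal_form (phi_map lam p q) lam eps s)
    \<and> (\<forall>lam' p' q' eps s eps' s'.
          admissible lam' p' q' \<and> (\<forall>n::nat. n > 0 \<longrightarrow> lam' ^ n \<noteq> 1) \<and>
          valid_invariants eps s \<and> has_normal_form (phi_map lam p q) lam eps s \<and>
          valid_invariants eps' s' \<and> has_normal_form (phi_map lam' p' q') lam' eps' s' \<longrightarrow>
          (real_formally_conjugate (phi_map lam p q) (phi_map lam' p' q')
             \<longleftrightarrow> (lam, eps, s) = (lam', eps', s')))"
proof (intro conjI allI impI)
  show "\<exists>eps s. valid_invariants eps s \<and> has_normal_form (phi_map lam p q) lam eps s"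
    using normal_form_exists[OF adm not_root] .
next
  fix lam' p' q' eps s eps' s'
  assume "admissible lam' p' q' \<and> (\<forall>n::nat. n > 0 \<longrightarrow> lam' ^ n \<noteq> 1) \<and>
          valid_invariants eps s \<and> has_normal_form (phi_map lam p q) lam eps s \<and>
          valid_invariants eps' s' \<and> has_normal_form (phi_map lam' p' q') lam' eps' s'"
  then have adm': "admissible lam' p' q'" and v: "valid_invariants eps s" "valid_invariants eps' s'"
    and nf: "has_normal_form (phi_map lam p q) lam eps s" "has_normal_form (phi_map lam' p' q') lam' eps' s'"
    by auto
  define \<phi> \<phi>' N N' where "\<phi> = mser (phi_map lam p q)" and "\<phi>' = mser (phi_map lam' p' q')"
    and "N = mser (normal_form lam eps s)" and "N' = mser (normal_form lam' eps' s')"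
  note A = admissible_mser[OF adm, folded \<phi>_def] and A' = admissible_mser[OF adm', folded \<phi>'_def]
  obtain \<Phi> a where \<Phi>: "a \<noteq> 0" "diag_linear a (cnj a) \<Phi>" "mflip cnj \<Phi> = \<Phi>" "\<Phi> \<odot> \<phi> = N \<odot> \<Phi>"
    using has_normal_formE[OF nf(1) v(1) adm, folded \<phi>_def N_def] .
  obtain \<Phi>' a' where \<Phi>': "a' \<noteq> 0" "diag_linear a' (cnj a') \<Phi>'" "mflip cnj \<Phi>' = \<Phi>'" "\<Phi>' \<odot> \<phi>' = N' \<odot> \<Phi>'"
    using has_normal_formE[OF nf(2) v(2) adm', folded \<phi>'_def N'_def] .
  have dN: "diag_linear lam (cnj lam) N" "diag_linear lam' (cnj lam') N'"
    by (simp_all add: N_def N'_def diag_linear_normal_form v)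
  note z = diag_linear_no_const[OF \<Phi>(2)] diag_linear_no_const[OF \<Phi>'(2)] diag_linear_no_const[OF A(1)] diag_linear_no_const[OF A'(1)] diag_linear_no_const[OF dN(1)] diag_linear_no_const[OF dN(2)]
  show "real_formally_conjugate (phi_map lam p q) (phi_map lam' p' q') \<longleftrightarrow> (lam, eps, s) = (lam', eps', s')"
  proof
    assume "real_formally_conjugate (phi_map lam p q) (phi_map lam' p' q')"
    then obtain \<Psi> where \<Psi>: "formal_transformation \<Psi>" "real_fmap \<Psi>"
      "\<Psi> \<circ>\<^sub>f phi_map lam p q = phi_map lam' p' q' \<circ>\<^sub>f \<Psi>" by (auto simp: real_formally_conjugate_def)
    have c: "mser \<Psi> \<odot> \<phi> = \<phi>' \<odot> mser \<Psi>" unfolding \<phi>_def \<phi>'_def by (metis \<Psi>(3) mser_comp)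
    have "Im lam > 0" "Im lam' > 0" using adm adm' by (simp_all add: admissible_def)
    then obtain b where lam: "lam = lam'" and b: "b \<noteq> 0" "diag_linear b (cnj b) (mser \<Psi>)"
      using real_conjugacy_linear[OF \<Psi>(1,2) A(1) A'(1) _ _ c] by blast
    \<comment> \<open>\<open>\<Omega>\<close> leads from \<open>N\<close> back to
      \<open>\<phi>\<close>; continuing with \<open>\<Psi>\<close> and \<open>\<Phi>'\<close> gives
      a conjugacy from \<open>N\<close> to \<open>N'\<close> with diagonal linear part.\<close>
    obtain \<Omega> where \<Omega>: "diag_linear (1 / a) (cnj (1 / a)) \<Omega>" "\<Phi> \<odot> \<Omega> = id_map" "\<Omega> \<odot> \<Phi> = id_map"
      using real_inverse[OF \<Phi>(1-3)] by metis
    have "\<Omega> \<odot> N = \<phi> \<odot> \<Omega>"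
      using conjugacy_inverse[OF \<Phi>(4) \<Omega>(2,3)] z diag_linear_no_const[OF \<Omega>(1)] by simp
    from conjugacy_trans[OF this c] have "(mser \<Psi> \<odot> \<Omega>) \<odot> N = \<phi>' \<odot> (mser \<Psi> \<odot> \<Omega>)"
      using z diag_linear_no_const[OF \<Omega>(1)] diag_linear_no_const[OF b(2)] by simp
    from conjugacy_trans[OF this \<Phi>'(4)]
    have "(\<Phi>' \<odot> (mser \<Psi> \<odot> \<Omega>)) \<odot> N = N' \<odot> (\<Phi>' \<odot> (mser \<Psi> \<odot> \<Omega>))"
      using z diag_linear_no_const[OF b(2)] by (simp add: no_const_mcomp)
    moreover have "diag_linear (a' * (b * (1 / a))) (cnj (a' * (b * (1 / a)))) (\<Phi>' \<odot> (mser \<Psi> \<odot> \<Omega>))"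
      using diag_linear_mcomp[OF \<Phi>'(2) diag_linear_mcomp[OF b(2) \<Omega>(1)]] by simp
    moreover have "a' * (b * (1 / a)) \<noteq> 0" using \<Phi>(1) \<Phi>'(1) b(1) by simp
    ultimately have "eps = eps' \<and> s = s'"
      using normal_form_invariants[OF A(2) v] lam unfolding N_def N'_def by blast
    then show "(lam, eps, s) = (lam', eps', s')" using lam by simp
  next
    assume "(lam, eps, s) = (lam', eps', s')"
    then have N: "N' = N" by (simp add: N_def N'_def)
    \<comment> \<open>The normal form is shared, so \<open>\<Phi>\<close> followed by the inverse
      \<open>\<Omega>\<close> of \<open>\<Phi>'\<close> conjugates \<open>\<phi>\<close> to
      \<open>\<phi>'\<close>.\<close>
    obtain \<Omega> where \<Omega>: "diag_linear (1 / a') (cnj (1 / a')) \<Omega>" "mflip cnj \<Omega> = \<Omega>" "\<Phi>' \<odot> \<Omega> = id_map" "\<Omega> \<odot> \<Phi>' = id_map"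
      using real_inverse[OF \<Phi>'(1-3)] by metis
    have "\<Omega> \<odot> N = \<phi>' \<odot> \<Omega>"
      using conjugacy_inverse[OF \<Phi>'(4) \<Omega>(3,4)] z diag_linear_no_const[OF \<Omega>(1)] by (simp add: N)
    from conjugacy_trans[OF \<Phi>(4) this] have c: "(\<Omega> \<odot> \<Phi>) \<odot> \<phi> = \<phi>' \<odot> (\<Omega> \<odot> \<Phi>)"
      using z diag_linear_no_const[OF \<Omega>(1)] by simp
    obtain \<Psi> where \<Psi>: "mser \<Psi> = \<Omega> \<odot> \<Phi>" by (rule mser_surj)
    have "formal_transformation \<Psi>"
      using formal_transformation_diag_linear[of "1 / a' * a" "cnj (1 / a') * cnj a" \<Psi>] diag_linear_mcomp[OF \<Omega>(1) \<Phi>(2)] \<Phi>(1) \<Phi>'(1)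
      by (simp add: \<Psi>)
    moreover have "real_fmap \<Psi>"
      using z by (simp add: real_fmap_iff \<Psi> mflip_mcomp cxhom_cnj \<Omega>(2) \<Phi>(3))
    moreover have "\<Psi> \<circ>\<^sub>f phi_map lam p q = phi_map lam' p' q' \<circ>\<^sub>f \<Psi>"
      using c by (simp add: \<Psi> mser_comp \<phi>_def \<phi>'_def flip: mser_inj)
    ultimately show "real_formally_conjugate (phi_map lam p q) (phi_map lam' p' q')"
      unfolding real_formally_conjugate_def by blast
  qed
qed

end
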